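(* Let $\mathcal{H}$ be a separable Hilbert space, $K\in B(\mathcal{H})$ an operator with closed range, and $W=\{(W_i,\omega_i)\}_{i\in I}$ a $K$-fusion frame for $\mathcal{H}$ with bounds $A$ and $B$. Then: (i) If $\{(\pi_{R(K)}W_i,\omega_i)\}_{i\in I}$ is a Bessel fusion sequence, then $\{(K^{\dagger}W_i,\omega_i)\}_{i\in I}$ is a fusion frame for $R(K^* )$. (ii) If $\{(\pi_{S_W(R(K))}W_i,\omega_i)\}_{i\in I}$ is a Bessel fusion sequence, then $\{(S_W^{-1}\pi_{S_W(R(K))}W_i,\omega_i)\}_{i\in I}$ is a fusion frame for $R(K)$. (iii) If $Q\in B(\mathcal{H})$ is invertible, then $\{(QW_i,\omega_i)\}_{i\in I}$ is a $QK$-fusion frame for $\mathcal{H}$. (iv) If $Q\in B(\mathcal{H})$ is invertible and $KQ=QK$, then $\{(QW_i,\omega_i)\}_{i\in I}$ is also a $K$-fusion frame for $\mathcal{H}$. (v) If $Q\in B(\mathcal{H})$ satisfies $R(Q)\subseteq R(K)$, then $W$ is also a $Q$-fusion frame for $\mathcal{H}$.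
   Context: $I$ is a countable index set; $R(T)$ is the range of $T$; $K^{\dagger}$ is the (Moore–Penrose) pseudo-inverse of $K$; $\pi_V$ is the orthogonal projection of $\mathcal{H}$ onto a closed subspace $V$. For closed subspaces $W_i\subseteq\mathcal{H}$ and weights $\omega_i>0$, $\{(W_i,\omega_i)\}_{i\in I}$ is a Bessel fusion sequence if there is $B<\infty$ with $\sum_{i}\omega_i^2\|\pi_{W_i}f\|^2\le B\|f\|^2$ for all $f\in\mathcal{H}$ (being a Bessel fusion sequence includes that the subspaces are closed). For $T\in B(\mathcal{H})$, it is a $T$-fusion frame for $\mathcal{H}$ with bounds $A,B$ if $0<A,B<\infty$ and $A\|T^*f\|^2\le\sum_{i}\omega_i^2\|\pi_{W_i}f\|^2\le B\|f\|^2$ for all $f\in\mathcal{H}$. A fusion frame for a closed subspace $M$ of $\mathcal{H}$ is a family $\{(V_i,\omega_i)\}$ of closed subspaces $V_i$ of $M$ with weights such that, for some $0<A\le B<\infty$, $A\|f\|^2\le\sum_i\omega_i^2\|\pi_{V_i}f\|^2\le B\|f\|^2$ for all $f\in M$. The frame operator is $S_Wf=\sum_i\omega_i^2\pi_{W_i}f$. When $K$ has closed range and $W$ is a $K$-fusion frame, $S_W(R(K))$ is closed and the restriction $S_W:R(K)\to S_W(R(K))$ is invertible with bounded inverse; $S_W^{-1}:S_W(R(K))\to R(K)$ denotes this inverse. *)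

theory Defs
  imports "HOL-Analysis.Analysis"
begin

section \<open>Hilbert spaces over the real or the complex numbers\<close>

text \<open>
  A field satisfying these axioms is, up to isomorphism, \<open>\<real>\<close> with the identity or \<open>\<complex>\<close> with
  complex conjugation: every \<open>x\<close> is a root of \<open>t\<^sup>2 - (x + sconj x) t + x * sconj x\<close>, whose
  coefficients are real (for \<open>x + sconj x\<close>, apply \<open>mult_sconj\<close> to \<open>1 + x\<close>).
\<close>

class real_or_complex = real_normed_field +
  fixes sconj :: "'a \<Rightarrow> 'a"
  assumes sconj_add: "sconj (x + y) = sconj x + sconj y"
    and sconj_mult: "sconj (x * y) = sconj x * sconj y"
    and sconj_sconj: "sconj (sconj x) = x"
    and sconj_scaleR_one: "sconj (r *\<^sub>R 1) = r *\<^sub>R 1"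
    and mult_sconj: "x * sconj x = (norm x)\<^sup>2 *\<^sub>R 1"

instantiation real :: real_or_complex
begin
definition sconj_real :: "real \<Rightarrow> real" where "sconj_real x = x"
instance by standard (simp_all add: sconj_real_def power2_eq_square)
end

instantiation complex :: real_or_complex
begin
definition sconj_complex :: "complex \<Rightarrow> complex" where "sconj_complex x = cnj x"
instance by standard (simp_all add: sconj_complex_def scaleR_conv_of_real complex_norm_square del: of_real_power)
end

text \<open>
  A Hilbert space over \<open>'k\<close>. The library's real inner product \<open>\<bullet>\<close> of the type \<open>'h\<close> only supplies
  the norm \<open>sqrt (ip x x)\<close> and its topology; by polarisation it is the real part of \<open>ip\<close>.
\<close>

locale hilbert_space = vector_space smul
  for smul :: "'k::real_or_complex \<Rightarrow> 'h::{real_inner, complete_space} \<Rightarrow> 'h" +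
  fixes ip :: "'h \<Rightarrow> 'h \<Rightarrow> 'k"
  assumes scale_of_real: "smul (of_real r) x = r *\<^sub>R x"
    and ip_add_left: "ip (x + y) z = ip x z + ip y z"
    and ip_scale_left: "ip (smul c x) y = c * ip x y"
    and ip_commute: "ip y x = sconj (ip x y)"
    and ip_self: "ip x x = of_real (x \<bullet> x)"

lemma hilbert_space_real:
  "hilbert_space (scaleR :: real \<Rightarrow> 'h::{real_inner, complete_space} \<Rightarrow> 'h) (\<bullet>)"
  by unfold_locales
    (simp_all add: algebra_simps inner_add_left sconj_real_def inner_commute)

lemma hilbert_space_complex:
  "hilbert_space ((*) :: complex \<Rightarrow> complex \<Rightarrow> complex) (\<lambda>x y. x * cnj y)"
  by unfold_locales
    (simp_all add: algebra_simps sconj_complex_def scaleR_conv_of_real complex_mult_cnj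
      inner_complex_def power2_eq_square)

section \<open>Operators and projections\<close>

definition bounded_operator ::
    "('k::real_or_complex \<Rightarrow> 'h::real_inner \<Rightarrow> 'h) \<Rightarrow> ('h \<Rightarrow> 'h) \<Rightarrow> bool" where
  "bounded_operator smul T \<longleftrightarrow>
     Vector_Spaces.linear smul smul T \<and> (\<exists>C. \<forall>x. norm (T x) \<le> C * norm x)"

definition invertible_operator ::
    "('k::real_or_complex \<Rightarrow> 'h::real_inner \<Rightarrow> 'h) \<Rightarrow> ('h \<Rightarrow> 'h) \<Rightarrow> bool" where
  "invertible_operator smul T \<longleftrightarrow> bounded_operator smul T \<and>
     (\<exists>T'. bounded_operator smul T' \<and> T \<circ> T' = id \<and> T' \<circ> T = id)"

definition adj :: "('h \<Rightarrow> 'h \<Rightarrow> 'k) \<Rightarrow> ('h \<Rightarrow> 'h) \<Rightarrow> 'h \<Rightarrow> 'h" where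
  "adj ip T = (THE T'. \<forall>x y. ip (T x) y = ip x (T' y))"

text \<open>The Moore--Penrose inverse, characterised by the four Penrose equations.\<close>

definition pseudo_inverse ::
    "('k::real_or_complex \<Rightarrow> 'h::real_inner \<Rightarrow> 'h) \<Rightarrow> ('h \<Rightarrow> 'h \<Rightarrow> 'k) \<Rightarrow> ('h \<Rightarrow> 'h) \<Rightarrow> 'h \<Rightarrow> 'h" where
  "pseudo_inverse smul ip K = (THE X. bounded_operator smul X \<and>
     K \<circ> X \<circ> K = K \<and> X \<circ> K \<circ> X = X \<and>
     adj ip (K \<circ> X) = K \<circ> X \<and> adj ip (X \<circ> K) = X \<circ> K)"

definition closed_subspace ::
    "('k::real_or_complex \<Rightarrow> 'h::real_inner \<Rightarrow> 'h) \<Rightarrow> 'h set \<Rightarrow> bool" where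
  "closed_subspace smul V \<longleftrightarrow> module.subspace smul V \<and> closed V"

definition proj :: "('h::real_inner \<Rightarrow> 'h \<Rightarrow> 'k::real_or_complex) \<Rightarrow> 'h set \<Rightarrow> 'h \<Rightarrow> 'h" where
  "proj ip V f = (THE p. p \<in> V \<and> (\<forall>v\<in>V. ip (f - p) v = 0))"

section \<open>Fusion frames\<close>

definition weighted_subspaces ::
    "('k::real_or_complex \<Rightarrow> 'h::real_inner \<Rightarrow> 'h) \<Rightarrow> 'i set \<Rightarrow> ('i \<Rightarrow> 'h set) \<Rightarrow> ('i \<Rightarrow> real) \<Rightarrow> bool" where
  "weighted_subspaces smul I V \<omega> \<longleftrightarrow> (\<forall>i\<in>I. closed_subspace smul (V i) \<and> 0 < \<omega> i)"

definition fusion_term ::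
    "('h::real_inner \<Rightarrow> 'h \<Rightarrow> 'k::real_or_complex) \<Rightarrow> ('i \<Rightarrow> 'h set) \<Rightarrow> ('i \<Rightarrow> real) \<Rightarrow> 'h \<Rightarrow> 'i \<Rightarrow> real" where
  "fusion_term ip V \<omega> f i = (\<omega> i)\<^sup>2 * (norm (proj ip (V i) f))\<^sup>2"

text \<open>
  Below, summability has to be required separately, because \<open>infsum\<close> of a divergent family is \<open>0\<close>.
\<close>

definition bessel_fusion_sequence ::
    "('k::real_or_complex \<Rightarrow> 'h::real_inner \<Rightarrow> 'h) \<Rightarrow> ('h \<Rightarrow> 'h \<Rightarrow> 'k) \<Rightarrow>
     'i set \<Rightarrow> ('i \<Rightarrow> 'h set) \<Rightarrow> ('i \<Rightarrow> real) \<Rightarrow> bool" where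
  "bessel_fusion_sequence smul ip I V \<omega> \<longleftrightarrow>
     weighted_subspaces smul I V \<omega> \<and>
     (\<exists>B. \<forall>f. fusion_term ip V \<omega> f summable_on I \<and>
        (\<Sum>\<^sub>\<infinity>i\<in>I. fusion_term ip V \<omega> f i) \<le> B * (norm f)\<^sup>2)"

definition op_fusion_frame_bounds ::
    "('k::real_or_complex \<Rightarrow> 'h::real_inner \<Rightarrow> 'h) \<Rightarrow> ('h \<Rightarrow> 'h \<Rightarrow> 'k) \<Rightarrow> ('h \<Rightarrow> 'h) \<Rightarrow>
     'i set \<Rightarrow> ('i \<Rightarrow> 'h set) \<Rightarrow> ('i \<Rightarrow> real) \<Rightarrow> real \<Rightarrow> real \<Rightarrow> bool" where
  "op_fusion_frame_bounds smul ip T I V \<omega> A B \<longleftrightarrow>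
     bounded_operator smul T \<and> weighted_subspaces smul I V \<omega> \<and> 0 < A \<and> 0 < B \<and>
     (\<forall>f. fusion_term ip V \<omega> f summable_on I \<and>
        A * (norm (adj ip T f))\<^sup>2 \<le> (\<Sum>\<^sub>\<infinity>i\<in>I. fusion_term ip V \<omega> f i) \<and>
        (\<Sum>\<^sub>\<infinity>i\<in>I. fusion_term ip V \<omega> f i) \<le> B * (norm f)\<^sup>2)"

definition op_fusion_frame ::
    "('k::real_or_complex \<Rightarrow> 'h::real_inner \<Rightarrow> 'h) \<Rightarrow> ('h \<Rightarrow> 'h \<Rightarrow> 'k) \<Rightarrow> ('h \<Rightarrow> 'h) \<Rightarrow>
     'i set \<Rightarrow> ('i \<Rightarrow> 'h set) \<Rightarrow> ('i \<Rightarrow> real) \<Rightarrow> bool" where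
  "op_fusion_frame smul ip T I V \<omega> \<longleftrightarrow> (\<exists>A B. op_fusion_frame_bounds smul ip T I V \<omega> A B)"

definition fusion_frame_for ::
    "('k::real_or_complex \<Rightarrow> 'h::real_inner \<Rightarrow> 'h) \<Rightarrow> ('h \<Rightarrow> 'h \<Rightarrow> 'k) \<Rightarrow> 'h set \<Rightarrow>
     'i set \<Rightarrow> ('i \<Rightarrow> 'h set) \<Rightarrow> ('i \<Rightarrow> real) \<Rightarrow> bool" where
  "fusion_frame_for smul ip M I V \<omega> \<longleftrightarrow>
     closed_subspace smul M \<and> weighted_subspaces smul I V \<omega> \<and> (\<forall>i\<in>I. V i \<subseteq> M) \<and>
     (\<exists>A B. 0 < A \<and> A \<le> B \<and>
       (\<forall>f\<in>M. fusion_term ip V \<omega> f summable_on I \<and>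
          A * (norm f)\<^sup>2 \<le> (\<Sum>\<^sub>\<infinity>i\<in>I. fusion_term ip V \<omega> f i) \<and>
          (\<Sum>\<^sub>\<infinity>i\<in>I. fusion_term ip V \<omega> f i) \<le> B * (norm f)\<^sup>2))"

definition frame_operator ::
    "('h::real_inner \<Rightarrow> 'h \<Rightarrow> 'k::real_or_complex) \<Rightarrow> 'i set \<Rightarrow> ('i \<Rightarrow> 'h set) \<Rightarrow> ('i \<Rightarrow> real) \<Rightarrow> 'h \<Rightarrow> 'h" where
  "frame_operator ip I V \<omega> f = (\<Sum>\<^sub>\<infinity>i\<in>I. (\<omega> i)\<^sup>2 *\<^sub>R proj ip (V i) f)"

end

theory Submission
  imports Defs
begin

text \<open>
  Write \<open>\<pi>\<^sub>V\<close> for the orthogonal projection onto \<open>V\<close> and \<open>\<Sigma>\<^sub>W f\<close> for the sum of the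
  \<open>\<omega>\<^sub>i\<^sup>2 \<parallel>\<pi>\<^sub>W\<^sub>i f\<parallel>\<^sup>2\<close>. The first four statements compare such sums for two families of
  subspaces, and one estimate suffices for that: if a bounded operator \<open>T\<close> maps \<open>V\<close> into \<open>U\<close>, then
  \<open>\<parallel>\<pi>\<^sub>V T\<^sup>* f\<parallel> \<le> \<parallel>T\<parallel> \<parallel>\<pi>\<^sub>U f\<parallel>\<close> (\<open>norm_proj_le_of_intertwining\<close>).

  Applied to an invertible \<open>Q\<close> and to its inverse, it shows that the images \<open>Q W\<^sub>i\<close> form a
  \<open>QK\<close>-fusion frame. That the range of an operator \<open>Q\<close> lies in \<open>R(K)\<close> means \<open>Q = K (K\<^sup>\<dagger> Q)\<close>, so
  \<open>\<parallel>Q\<^sup>* f\<parallel>\<close> is at most a multiple of \<open>\<parallel>K\<^sup>* f\<parallel>\<close> and every \<open>K\<close>-fusion frame is a \<open>Q\<close>-fusion frame.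
  If an invertible \<open>Q\<close> commutes with \<open>K\<close>, then \<open>R(QK) = R(K)\<close>, and the two facts together make
  the \<open>Q W\<^sub>i\<close> a \<open>K\<close>-fusion frame.

  The statements on \<open>K\<^sup>\<dagger>\<close> and on \<open>S\<^sub>W\<^sup>-\<^sup>1\<close> are instances of one lemma (\<open>fusion_frame_for_image\<close>):
  an \<open>L\<close>-fusion frame is carried to a fusion frame for \<open>M\<close> by any bounded \<open>T\<close> with range in \<open>M\<close>,
  \<open>T L = 1\<close> on \<open>M\<close> and \<open>L T = \<pi>\<^sub>N\<close>, provided that the \<open>\<pi>\<^sub>N W\<^sub>i\<close> form a Bessel fusion sequence.
  For the first, \<open>L = K\<close> and \<open>T = K\<^sup>\<dagger>\<close>. For the second, \<open>L = S\<^sub>W\<close>: the inequality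
  \<open>\<parallel>S\<^sub>W f\<parallel>\<^sup>2 \<le> B \<Sigma>\<^sub>W f\<close> says that \<open>W\<close> is a fusion frame relative to its own frame operator.

  The Hilbert space theory consists of projections and adjoints, obtained by minimising a
  quadratic functional (\<open>riesz_coercive\<close>), and of the pseudo-inverse of an operator with closed
  range. Its boundedness rests on \<open>\<parallel>f\<parallel> \<le> c \<parallel>K\<^sup>* f\<parallel>\<close> for \<open>f\<close> in \<open>R(K)\<close>
  (\<open>adj_coercive_on_range\<close>), a consequence of the uniform boundedness principle.
\<close>

section \<open>Riesz representation and uniform boundedness\<close>

lemma linear_term_vanishes:
  fixes a b :: real
  assumes "\<And>t. 0 \<le> a * t\<^sup>2 + 2 * b * t" "0 \<le> a"
  shows "b = 0"
proof (rule ccontr)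
  assume b: "b \<noteq> 0"
  \<comment> \<open>The value at \<open>-u\<close> is \<open>-(a + 2) * u\<^sup>2\<close>; the denominator \<open>a + 1\<close> also covers \<open>a = 0\<close>.\<close>
  define u where "u = b / (a + 1)"
  have bu: "b = u * (a + 1)" using assms(2) by (simp add: u_def)
  have "0 \<le> a * (- u)\<^sup>2 + 2 * b * (- u)" by (rule assms(1))
  also have "\<dots> = - (u\<^sup>2 * (a + 2))"
    by (simp add: bu algebra_simps power2_eq_square)
  also have "\<dots> < 0" using b bu assms(2) by simp
  finally show False by simp
qed

text \<open>
  Minimising the energy \<open>\<parallel>T v\<parallel>\<^sup>2 - 2 \<phi> v\<close> over \<open>M\<close>: the parallelogram law and coercivity make
  minimising sequences Cauchy, and the first-order condition at the minimiser is the claimed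
  identity. The three uses are orthogonal projections (\<open>T\<close> the identity, \<open>\<phi> = (\<bullet>) f\<close>), Riesz
  representation and hence adjoints (\<open>M\<close> the whole space), and the normal equation
  \<open>K K\<^sup>* p = \<pi> y\<close> behind the pseudo-inverse (\<open>T = K\<^sup>*\<close>, \<open>M = R(K)\<close>).
\<close>

lemma riesz_coercive:
  fixes M :: "'h::{real_inner, complete_space} set"
  assumes M: "subspace M" "closed M"
    and T: "bounded_linear (T :: 'h \<Rightarrow> 'h)" and \<phi>: "bounded_linear (\<phi> :: 'h \<Rightarrow> real)"
    and coercive: "\<And>v. v \<in> M \<Longrightarrow> norm v \<le> c * norm (T v)"
  shows "\<exists>p\<in>M. \<forall>v\<in>M. T p \<bullet> T v = \<phi> v"
proof -
  interpret T: bounded_linear T by fact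
  interpret \<phi>: bounded_linear \<phi> by fact
  obtain C where C: "C \<ge> 0" "\<And>v. \<bar>\<phi> v\<bar> \<le> norm v * C"
    using \<phi>.nonneg_bounded by auto
  define J where "J v = (norm (T v))\<^sup>2 - 2 * \<phi> v" for v
  have expand: "J (u + t *\<^sub>R v) = J u + (norm (T v))\<^sup>2 * t\<^sup>2 + 2 * (T u \<bullet> T v - \<phi> v) * t" for u v t
    unfolding J_def power2_norm_eq_inner
    by (simp add: T.add T.scaleR \<phi>.add \<phi>.scaleR inner_add_left inner_add_right
        inner_commute algebra_simps power2_eq_square)
  have bound: "- (C * c)\<^sup>2 \<le> J v" if "v \<in> M" for v
  proof -
    have "\<phi> v \<le> norm v * C" using C(2)[of v] by simp
    also have "\<dots> \<le> C * c * norm (T v)"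
      using mult_right_mono[OF coercive[OF that] C(1)] by (simp add: algebra_simps)
    finally have "\<phi> v \<le> C * c * norm (T v)" .
    moreover have "0 \<le> (norm (T v) - C * c)\<^sup>2" by simp
    ultimately show ?thesis by (simp add: J_def power2_diff algebra_simps)
  qed
  define m where "m = Inf (J ` M)"
  have ne: "J ` M \<noteq> {}" using subspace_0[OF M(1)] by auto
  have bdd: "bdd_below (J ` M)" using bound by (intro bdd_belowI2) auto
  have m_le: "m \<le> J v" if "v \<in> M" for v
    unfolding m_def using bdd that by (intro cInf_lower) auto
  have "\<exists>v\<in>M. J v < m + 1 / real (Suc n)" for n
  proof -
    have "Inf (J ` M) < m + 1 / real (Suc n)" by (simp add: m_def)
    from cInf_lessD[OF ne this] show ?thesis by auto
  qed
  then obtain u where u: "\<And>n. u n \<in> M" "\<And>n. J (u n) < m + 1 / real (Suc n)" by metis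
  have gap: "(norm (v - w))\<^sup>2 \<le> 2 * c\<^sup>2 * (J v + J w - 2 * m)" if vw: "v \<in> M" "w \<in> M" for v w
  proof -
    have mid: "(1/2) *\<^sub>R (v + w) \<in> M" using vw M(1) by (simp add: subspace_add subspace_scale)
    have "J v + J w - 2 * J ((1/2) *\<^sub>R (v + w)) = (norm (T (v - w)))\<^sup>2 / 2"
      by (simp add: J_def T.add T.diff T.scaleR \<phi>.add \<phi>.scaleR power2_norm_eq_inner
          inner_add_left inner_add_right inner_diff_left inner_diff_right inner_commute
          field_simps)
    then have "(norm (T (v - w)))\<^sup>2 \<le> 2 * (J v + J w - 2 * m)"
      using m_le[OF mid] by simp
    moreover have "norm (v - w) \<le> c * norm (T (v - w))"
      using vw M(1) by (intro coercive) (simp add: subspace_diff)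
    then have "(norm (v - w))\<^sup>2 \<le> (c * norm (T (v - w)))\<^sup>2" by (intro power_mono) auto
    ultimately show ?thesis
      using mult_left_mono[of "(norm (T (v - w)))\<^sup>2" "2 * (J v + J w - 2 * m)" "c\<^sup>2"]
      by (simp add: power_mult_distrib algebra_simps)
  qed
  have "Cauchy u"
  proof (rule metric_CauchyI)
    fix e :: real assume e: "0 < e"
    have "(\<lambda>n. 4 * c\<^sup>2 * (1 / real (Suc n))) \<longlonglongrightarrow> 4 * c\<^sup>2 * 0"
      by (intro tendsto_mult_left lim_1_over_n[THEN LIMSEQ_Suc])
    then have "\<forall>\<^sub>F n in sequentially. 4 * c\<^sup>2 * (1 / real (Suc n)) < e\<^sup>2"
      using e by (intro order_tendstoD(2)) auto
    then obtain N where N: "\<And>n. n \<ge> N \<Longrightarrow> 4 * c\<^sup>2 * (1 / real (Suc n)) < e\<^sup>2"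
      by (auto simp: eventually_sequentially)
    have "dist (u i) (u j) < e" if ij: "i \<ge> N" "j \<ge> N" for i j
    proof -
      have dec: "1 / real (Suc k) \<le> 1 / real (Suc N)" if "k \<ge> N" for k
        using that by (simp add: frac_le)
      have "(norm (u i - u j))\<^sup>2 \<le> 2 * c\<^sup>2 * (J (u i) + J (u j) - 2 * m)"
        using u(1) by (intro gap) auto
      also have "\<dots> \<le> 2 * c\<^sup>2 * (2 * (1 / real (Suc N)))"
        using u(2)[of i] u(2)[of j] dec[OF ij(1)] dec[OF ij(2)] by (intro mult_left_mono) auto
      also have "\<dots> < e\<^sup>2" using N[of N] by simp
      finally show ?thesis using e by (simp add: dist_norm power_less_imp_less_base)
    qed
    then show "\<exists>N. \<forall>i\<ge>N. \<forall>j\<ge>N. dist (u i) (u j) < e" by blast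
  qed
  then obtain p where p: "u \<longlonglongrightarrow> p" by (meson Cauchy_convergent convergent_def)
  have pM: "p \<in> M" using M(2) u(1) p closed_sequentially by blast
  have "(\<lambda>n. J (u n)) \<longlonglongrightarrow> J p" unfolding J_def
    by (intro tendsto_intros T.tendsto \<phi>.tendsto p)
  moreover have "(\<lambda>n. m + 1 / real (Suc n)) \<longlonglongrightarrow> m + 0"
    by (intro tendsto_add tendsto_const lim_1_over_n[THEN LIMSEQ_Suc])
  ultimately have "J p \<le> m + 0"
    using u(2) by (intro LIMSEQ_le[of "\<lambda>n. J (u n)" "J p"]) (auto intro: less_imp_le)
  have "T p \<bullet> T v = \<phi> v" if v: "v \<in> M" for v
  proof -
    have "0 \<le> (norm (T v))\<^sup>2 * t\<^sup>2 + 2 * (T p \<bullet> T v - \<phi> v) * t" for t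
      using expand[of p t v] \<open>J p \<le> m + 0\<close> m_le[of "p + t *\<^sub>R v"] pM v M(1)
      by (simp add: subspace_add subspace_scale)
    from linear_term_vanishes[OF this] show ?thesis by simp
  qed
  with pM show ?thesis by blast
qed

text \<open>
  The uniform boundedness principle, by a gliding hump instead of Baire's theorem: if
  \<open>\<parallel>f n\<parallel> > 4 ^ n\<close>, add steps of length \<open>3 ^ -n\<close> in the direction of \<open>\<plusminus> f n\<close>, the sign being the one
  that prevents cancellation. All later steps together have length at most \<open>3 ^ -n / 2\<close>, so they
  undo at most half of the gain, and the limit \<open>h\<close> pairs with \<open>f n\<close> to at least
  \<open>(4/3) ^ n / 2\<close>.
\<close>

lemma weakly_bounded_imp_bounded:
  fixes F :: "'h::{real_inner, complete_space} set"
  assumes weak: "\<And>h. \<exists>C. \<forall>f\<in>F. \<bar>f \<bullet> h\<bar> \<le> C"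
  shows "\<exists>C. \<forall>f\<in>F. norm f \<le> C"
proof (rule ccontr)
  assume "\<not> ?thesis"
  then have "\<forall>n. \<exists>f\<in>F. norm f > 4 ^ n" by (meson not_le)
  then obtain f where f: "\<And>n. f n \<in> F" "\<And>n::nat. norm (f n) > 4 ^ n" by metis
  have f0: "norm (f n) > 0" for n using less_trans[OF _ f(2)[of n], of 0] by simp
  define step where
    "step n y = ((if f n \<bullet> y \<ge> 0 then 1 else - 1) * (1 / 3) ^ n / norm (f n)) *\<^sub>R f n" for n y
  define x where "x = rec_nat 0 (\<lambda>n y. y + step n y)"
  have x_Suc: "x (Suc n) = x n + step n (x n)" for n by (simp add: x_def)
  have norm_step: "norm (step n y) = (1 / 3) ^ n" for n y
    using f0[of n] by (simp add: step_def abs_mult)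
  have large: "(1 / 3) ^ n * norm (f n) \<le> \<bar>f n \<bullet> x (Suc n)\<bar>" for n
  proof -
    have "f n \<bullet> x (Suc n) = f n \<bullet> x n
        + (if f n \<bullet> x n \<ge> 0 then 1 else - 1) * ((1 / 3) ^ n * norm (f n))"
      using f0[of n] by (simp add: x_Suc step_def inner_add_right dot_square_norm power2_eq_square)
    moreover have "0 \<le> (1 / 3) ^ n * norm (f n)" by simp
    ultimately show ?thesis by (auto split: if_splits)
  qed
  have close: "norm (x (n + k) - x n) \<le> (3 / 2) * ((1 / 3) ^ n - (1 / 3) ^ (n + k))" for n k
  proof (induction k)
    case (Suc k)
    have "norm (x (n + Suc k) - x n) \<le> norm (x (n + k) - x n) + norm (step (n + k) (x (n + k)))"
      using norm_triangle_ineq[of "x (n + k) - x n" "step (n + k) (x (n + k))"]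
      by (simp add: x_Suc algebra_simps)
    then show ?case using Suc by (simp add: norm_step algebra_simps)
  qed simp
  have close': "norm (x m - x n) \<le> (3 / 2) * (1 / 3) ^ n" if "n \<le> m" for m n
  proof -
    have "norm (x m - x n) \<le> (3 / 2) * ((1 / 3) ^ n - (1 / 3) ^ m)"
      using close[of n "m - n"] that by simp
    also have "\<dots> \<le> (3 / 2) * (1 / 3) ^ n" by simp
    finally show ?thesis .
  qed
  have "Cauchy x"
  proof (rule metric_CauchyI)
    fix e :: real assume "0 < e"
    then obtain N where N: "(1 / 3) ^ N < e / 3" using real_arch_pow_inv[of "e / 3" "1 / 3"] by auto
    have "dist (x i) (x j) < e" if "i \<ge> N" "j \<ge> N" for i j
    proof -
      have "dist (x i) (x j) \<le> norm (x i - x N) + norm (x j - x N)"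
        using norm_triangle_ineq4[of "x i - x N" "x j - x N"] by (simp add: dist_norm)
      also have "\<dots> < e" using close'[OF that(1)] close'[OF that(2)] N by simp
      finally show ?thesis .
    qed
    then show "\<exists>N. \<forall>i\<ge>N. \<forall>j\<ge>N. dist (x i) (x j) < e" by blast
  qed
  then obtain h where h: "x \<longlonglongrightarrow> h" by (meson Cauchy_convergent convergent_def)
  have tail: "norm (h - x n) \<le> (3 / 2) * (1 / 3) ^ n" for n
  proof (rule tendsto_upperbound)
    show "(\<lambda>m. norm (x m - x n)) \<longlonglongrightarrow> norm (h - x n)" by (intro tendsto_intros h)
    show "\<forall>\<^sub>F m in sequentially. norm (x m - x n) \<le> (3 / 2) * (1 / 3) ^ n"
      using close' by (auto simp: eventually_sequentially)
  qed simp
  obtain C where C: "\<And>n. \<bar>f n \<bullet> h\<bar> \<le> C" using weak[of h] f(1) by blast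
  obtain n where n: "2 * C < (4 / 3) ^ n" using real_arch_pow[of "4 / 3" "2 * C"] by auto
  have "\<bar>f n \<bullet> (h - x (Suc n))\<bar> \<le> norm (f n) * ((1 / 2) * (1 / 3) ^ n)"
    using order_trans[OF Cauchy_Schwarz_ineq2 mult_left_mono[OF tail[of "Suc n"]]] by simp
  then have "(1 / 3) ^ n * norm (f n) / 2 \<le> \<bar>f n \<bullet> h\<bar>"
    using large[of n] unfolding inner_diff_right
    by (simp only: mult.commute[of "norm (f n)"] mult.assoc)
  moreover have "(1 / 3) ^ n * 4 ^ n \<le> (1 / 3) ^ n * norm (f n)"
    using f(2)[of n] by (intro mult_left_mono) auto
  moreover have "(1 / 3 :: real) ^ n * 4 ^ n = (4 / 3) ^ n" by (simp flip: power_mult_distrib)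
  ultimately show False using C[of n] n by simp
qed

section \<open>Reduction to the real inner product\<close>

context hilbert_space
begin

text \<open>
  By polarisation \<open>\<bullet>\<close> is the real part of \<open>ip\<close>. For subspaces and operators that respect \<open>smul\<close>,
  orthogonality and adjointness mean the same for both forms, because the remaining part of
  \<open>ip x y\<close> is recovered from the numbers \<open>smul c x \<bullet> y\<close>. Once projections and
  adjoints are characterised by \<open>\<bullet>\<close>, the arguments use it alone.
\<close>

lemma ip_add_commuted: "ip x y + sconj (ip x y) = of_real (2 * (x \<bullet> y))"
proof -
  have "ip z (x + y) = ip z x + ip z y" for z
    by (metis ip_add_left ip_commute sconj_add)
  then have "ip (x + y) (x + y) = ip x x + ip x y + (ip y x + ip y y)"
    by (simp add: ip_add_left)
  then show ?thesis
    by (simp add: ip_self ip_commute[of x y] sconj_sconj inner_add_left inner_add_right inner_commute algebra_simps)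
qed

lemma sconj_of_real [simp]: "sconj (of_real r :: 'k) = of_real r"
  using sconj_scaleR_one[of r] by (simp add: of_real_def)

lemma ip_eqI:
  assumes "\<And>c. smul c x \<bullet> y = smul c x' \<bullet> y'"
  shows "ip x y = ip x' y'"
proof -
  define d where "d = ip x y - ip x' y'"
  have eq: "c * ip x y + sconj (c * ip x y) = c * ip x' y' + sconj (c * ip x' y')" for c
    using ip_add_commuted[of "smul c x" y] ip_add_commuted[of "smul c x'" y'] assms[of c]
    by (simp add: ip_scale_left)
  have sconj_diff: "sconj (a - b) = sconj a - sconj b" for a b :: 'k
    using sconj_add[of "a - b" b] by (simp add: eq_diff_eq)
  have "c * d + sconj (c * d) = 0" for c
  proof -
    have "c * d + sconj (c * d)
        = (c * ip x y + sconj (c * ip x y)) - (c * ip x' y' + sconj (c * ip x' y'))"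
      by (simp only: d_def right_diff_distrib sconj_diff add_diff_add)
    then show ?thesis by (simp only: eq diff_self)
  qed
  \<comment> \<open>With \<open>c = sconj d\<close> the product \<open>c * d\<close> is \<open>\<bar>d\<bar>\<^sup>2\<close>, which is its own conjugate.\<close>
  from this[of "sconj d"] have "d * sconj d + d * sconj d = 0"
    by (simp add: sconj_mult sconj_sconj mult.commute)
  then show ?thesis by (simp add: mult_sconj d_def flip: mult_2)
qed

lemma inner_eq_0_if_ip: "ip x y = 0 \<Longrightarrow> x \<bullet> y = 0"
  using ip_add_commuted[of x y] sconj_of_real[of 0] by simp

lemma inner_eq_if_ip: "ip x y = ip x' y' \<Longrightarrow> x \<bullet> y = x' \<bullet> y'"
  using ip_add_commuted[of x y] ip_add_commuted[of x' y']
  by (metis mult_cancel_left of_real_eq_iff zero_neq_numeral)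

lemma inner_smul: "smul c x \<bullet> y = x \<bullet> smul (sconj c) y"
proof (rule inner_eq_if_ip)
  have "ip x (smul (sconj c) y) = sconj (sconj c * ip y x)"
    by (metis ip_commute ip_scale_left)
  then show "ip (smul c x) y = ip x (smul (sconj c) y)"
    by (simp add: sconj_mult sconj_sconj ip_scale_left flip: ip_commute)
qed

lemma norm_smul: "norm (smul c x) = norm c * norm x"
proof -
  have "smul (sconj c) (smul c x) = ((norm c)\<^sup>2) *\<^sub>R x"
    using mult_sconj[of c] scale_of_real[of "(norm c)\<^sup>2" x]
    by (simp add: mult.commute of_real_def)
  then have "(norm (smul c x))\<^sup>2 = (norm c * norm x)\<^sup>2"
    by (simp add: power2_norm_eq_inner inner_smul power_mult_distrib)
  then show ?thesis by (simp add: power2_eq_iff_nonneg)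
qed

lemma linear_smul_iff:
  "Vector_Spaces.linear smul smul T \<longleftrightarrow>
     (\<forall>x y. T (x + y) = T x + T y) \<and> (\<forall>c x. T (smul c x) = smul c (T x))"
  unfolding module_hom_iff_linear[symmetric] module_hom_iff using module_axioms by auto

lemma bounded_operatorI:
  assumes "\<And>x y. T (x + y) = T x + T y" "\<And>c x. T (smul c x) = smul c (T x)"
    and "\<And>x. norm (T x) \<le> C * norm x"
  shows "bounded_operator smul T"
  unfolding bounded_operator_def linear_smul_iff using assms by blast

lemma bounded_operator_iff:
  "bounded_operator smul T \<longleftrightarrow> bounded_linear T \<and> (\<forall>c x. T (smul c x) = smul c (T x))"
proof
  assume "bounded_operator smul T"
  then obtain C where T: "\<And>x y. T (x + y) = T x + T y" "\<And>c x. T (smul c x) = smul c (T x)"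
      "\<And>x. norm (T x) \<le> C * norm x"
    unfolding bounded_operator_def linear_smul_iff by auto
  have "bounded_linear T"
    by (rule bounded_linear_intro[where K = C])
      (use T in \<open>simp_all add: mult.commute flip: scale_of_real\<close>)
  with T show "bounded_linear T \<and> (\<forall>c x. T (smul c x) = smul c (T x))" by simp
next
  assume *: "bounded_linear T \<and> (\<forall>c x. T (smul c x) = smul c (T x))"
  then interpret T: bounded_linear T by simp
  show "bounded_operator smul T"
    unfolding bounded_operator_def linear_smul_iff using T.bounded * T.add
    by (auto simp: mult.commute)
qed

lemma bounded_operator_linear: "bounded_operator smul T \<Longrightarrow> bounded_linear T"
  by (simp add: bounded_operator_iff)

lemma bounded_operator_smul: "bounded_operator smul T \<Longrightarrow> T (smul c x) = smul c (T x)"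
  by (simp add: bounded_operator_iff)

lemma bounded_operator_norm_le:
  assumes "bounded_operator smul T"
  obtains C where "0 < C" "\<And>x. norm (T x) \<le> C * norm x"
  using bounded_linear.pos_bounded[OF bounded_operator_linear[OF assms]] by (auto simp: mult.commute)

lemma bounded_operator_comp:
  "bounded_operator smul T \<Longrightarrow> bounded_operator smul U \<Longrightarrow> bounded_operator smul (T \<circ> U)"
  by (simp add: bounded_operator_iff bounded_linear_compose comp_def)

lemma closed_subspace_iff:
  "closed_subspace smul V \<longleftrightarrow>
     Real_Vector_Spaces.subspace V \<and> closed V \<and> (\<forall>c. \<forall>x\<in>V. smul c x \<in> V)"
  unfolding closed_subspace_def subspace_def Real_Vector_Spaces.subspace_def
  by (auto simp flip: scale_of_real)

lemma closed_subspace_real: "closed_subspace smul V \<Longrightarrow> Real_Vector_Spaces.subspace V"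
  by (simp add: closed_subspace_iff)

lemma closed_subspace_closed: "closed_subspace smul V \<Longrightarrow> closed V"
  by (simp add: closed_subspace_iff)

lemma closed_subspace_smul: "closed_subspace smul V \<Longrightarrow> x \<in> V \<Longrightarrow> smul c x \<in> V"
  by (simp add: closed_subspace_iff)

lemma closed_subspace_image:
  assumes "bounded_operator smul T" "closed_subspace smul V" "closed (T ` V)"
  shows "closed_subspace smul (T ` V)"
proof -
  interpret T: bounded_linear T using assms(1) by (rule bounded_operator_linear)
  show ?thesis using assms T.linear_axioms unfolding closed_subspace_iff bounded_operator_iff
    by (metis (no_types, lifting) Real_Vector_Spaces.linear_subspace_image image_iff)
qed

lemma closed_subspace_UNIV: "closed_subspace smul UNIV"
  by (simp add: closed_subspace_iff Real_Vector_Spaces.subspace_def)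

lemma closed_subspace_vimage:
  assumes T: "bounded_operator smul T" and V: "closed_subspace smul V"
  shows "closed_subspace smul (T -` V)"
proof -
  interpret T: bounded_linear T using T by (rule bounded_operator_linear)
  have "closed (T -` V)"
    using V by (intro continuous_closed_vimage T.isCont[OF continuous_ident]) (simp add: closed_subspace_iff)
  then show ?thesis using V T.linear_axioms bounded_operator_smul[OF T]
    by (simp add: closed_subspace_iff linear_subspace_vimage)
qed

lemma closed_subspace_Int:
  "closed_subspace smul V \<Longrightarrow> closed_subspace smul U \<Longrightarrow> closed_subspace smul (V \<inter> U)"
  by (simp add: closed_subspace_iff Real_Vector_Spaces.subspace_inter closed_Int)

section \<open>Orthogonal projections and adjoints\<close>

lemma proj_eqI:
  assumes V: "closed_subspace smul V" and p: "p \<in> V" "\<And>v. v \<in> V \<Longrightarrow> p \<bullet> v = f \<bullet> v"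
  shows "proj ip V f = p"
  unfolding proj_def
proof (rule the_equality)
  have "ip (f - p) v = ip 0 0" if "v \<in> V" for v
  proof (rule ip_eqI)
    fix c show "smul c (f - p) \<bullet> v = smul c 0 \<bullet> 0"
      using p(2)[OF closed_subspace_smul[OF V that]] by (simp add: inner_smul inner_diff_left)
  qed
  then show "p \<in> V \<and> (\<forall>v\<in>V. ip (f - p) v = 0)" using p(1) by (simp add: ip_self)
next
  fix q assume q: "q \<in> V \<and> (\<forall>v\<in>V. ip (f - q) v = 0)"
  have "q - p \<in> V" using q p(1) closed_subspace_real[OF V] by (simp add: Real_Vector_Spaces.subspace_diff)
  then have "(q - p) \<bullet> (q - p) = 0"
    using q p(2)[of "q - p"] inner_eq_0_if_ip[of "f - q" "q - p"]
    by (simp add: inner_diff_left)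
  then show "q = p" by simp
qed

lemma proj_exists:
  assumes V: "closed_subspace smul V"
  shows "proj ip V f \<in> V \<and> (\<forall>v\<in>V. proj ip V f \<bullet> v = f \<bullet> v)"
proof -
  obtain p where "p \<in> V" "\<forall>v\<in>V. p \<bullet> v = f \<bullet> v"
    using riesz_coercive[of V "\<lambda>x. x" "\<lambda>v. f \<bullet> v" 1] closed_subspace_real[OF V]
      closed_subspace_closed[OF V] by (auto simp: bounded_linear_inner_right)
  with proj_eqI[OF V, of p f] show ?thesis by simp
qed

lemma proj_in: "closed_subspace smul V \<Longrightarrow> proj ip V f \<in> V"
  and proj_inner: "closed_subspace smul V \<Longrightarrow> v \<in> V \<Longrightarrow> proj ip V f \<bullet> v = f \<bullet> v"
  using proj_exists by auto

lemma proj_ident: "closed_subspace smul V \<Longrightarrow> v \<in> V \<Longrightarrow> proj ip V v = v"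
  by (rule proj_eqI) auto

lemma proj_symmetric: "closed_subspace smul V \<Longrightarrow> proj ip V f \<bullet> g = f \<bullet> proj ip V g"
  by (metis inner_commute proj_in proj_inner)

lemma norm_proj_le: "closed_subspace smul V \<Longrightarrow> norm (proj ip V f) \<le> norm f"
  by (metis norm_cauchy_schwarz mult_right_le_imp_le norm_eq_zero norm_ge_zero
      order_le_less power2_eq_square power2_norm_eq_inner proj_in proj_inner)

lemma bounded_operator_proj:
  assumes V: "closed_subspace smul V"
  shows "bounded_operator smul (proj ip V)"
proof (rule bounded_operatorI[where C = 1])
  fix f g c
  note sub = closed_subspace_real[OF V]
  show "proj ip V (f + g) = proj ip V f + proj ip V g"
    using V sub by (intro proj_eqI)
      (auto simp: proj_in proj_inner inner_add_left Real_Vector_Spaces.subspace_add)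
  show "proj ip V (smul c f) = smul c (proj ip V f)"
    using V by (intro proj_eqI) (auto simp: proj_in proj_inner inner_smul closed_subspace_smul)
  show "norm (proj ip V f) \<le> 1 * norm f" by (simp add: norm_proj_le V)
qed

lemma adj_eqI:
  assumes T: "bounded_operator smul T" and T': "\<And>x y. T x \<bullet> y = x \<bullet> T' y"
  shows "adj ip T = T'"
  unfolding adj_def
proof (rule the_equality)
  show "\<forall>x y. ip (T x) y = ip x (T' y)"
    by (intro allI ip_eqI) (simp flip: bounded_operator_smul[OF T] T')
next
  fix U assume U: "\<forall>x y. ip (T x) y = ip x (U y)"
  show "U = T'"
  proof
    fix y
    have "x \<bullet> U y = x \<bullet> T' y" for x
      using inner_eq_if_ip U T' by metis
    then show "U y = T' y" by (metis vector_eq_ldot)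
  qed
qed

lemma inner_adj:
  assumes T: "bounded_operator smul T"
  shows "T x \<bullet> y = x \<bullet> adj ip T y"
proof -
  note lin = bounded_operator_linear[OF T]
  have "\<exists>p. \<forall>x. T x \<bullet> y = x \<bullet> p" for y
    using riesz_coercive[of UNIV "\<lambda>x. x" "\<lambda>x. T x \<bullet> y" 1]
      bounded_linear_compose[OF bounded_linear_inner_left lin]
    by (simp add: inner_commute) metis
  then obtain T' where "\<And>x y. T x \<bullet> y = x \<bullet> T' y" by metis
  then show ?thesis using adj_eqI[OF T] by metis
qed

lemma adj_inner: "bounded_operator smul T \<Longrightarrow> adj ip T x \<bullet> y = x \<bullet> T y"
  by (metis inner_adj inner_commute)

lemma bounded_operator_adj:
  assumes T: "bounded_operator smul T"
  shows "bounded_operator smul (adj ip T)"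
proof -
  obtain C where C: "0 < C" "\<And>x. norm (T x) \<le> C * norm x"
    using bounded_operator_norm_le[OF T] by blast
  show ?thesis
  proof (rule bounded_operatorI[where C = C])
    fix f g c
    show "adj ip T (f + g) = adj ip T f + adj ip T g"
      by (rule vector_eq_rdot[THEN iffD1]) (simp add: adj_inner[OF T] inner_add_left)
    show "adj ip T (smul c f) = smul c (adj ip T f)"
      by (rule vector_eq_rdot[THEN iffD1])
        (simp add: adj_inner[OF T] inner_smul bounded_operator_smul[OF T])
    have "norm (adj ip T f) * norm (adj ip T f) = T (adj ip T f) \<bullet> f"
      by (simp add: inner_adj[OF T] dot_square_norm power2_eq_square)
    also have "\<dots> \<le> C * norm (adj ip T f) * norm f"
      by (rule order_trans[OF norm_cauchy_schwarz mult_right_mono[OF C(2)]]) simp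
    finally show "norm (adj ip T f) \<le> C * norm f"
      using C(1) by (cases "adj ip T f = 0") (auto simp: mult.commute)
  qed
qed

lemma adj_comp:
  assumes "bounded_operator smul T" "bounded_operator smul U"
  shows "adj ip (T \<circ> U) = adj ip U \<circ> adj ip T"
  using assms by (intro adj_eqI) (auto simp: bounded_operator_comp inner_adj)

text \<open>
  The estimate that compares the terms of two families. The norm of \<open>\<pi>\<^sub>V g\<close> is the norm of the functional
  \<open>g \<bullet> _\<close> on \<open>V\<close>; if a bounded \<open>T\<close> carries \<open>V\<close> into \<open>U\<close> and this functional to \<open>f \<bullet> _\<close>, then
  only the component of \<open>f\<close> in \<open>U\<close> counts. The typical case is \<open>g = T\<^sup>* f\<close>.
\<close>

lemma norm_proj_le_of_intertwining:
  assumes V: "closed_subspace smul V" and U: "closed_subspace smul U" and "0 \<le> C"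
    and T: "\<And>v. v \<in> V \<Longrightarrow> T v \<in> U" "\<And>v. v \<in> V \<Longrightarrow> norm (T v) \<le> C * norm v"
      "\<And>v. v \<in> V \<Longrightarrow> g \<bullet> v = f \<bullet> T v"
  shows "norm (proj ip V g) \<le> C * norm (proj ip U f)"
proof -
  define v where "v = proj ip V g"
  have v: "v \<in> V" by (simp add: v_def proj_in V)
  have "norm v * norm v = g \<bullet> v"
    by (metis V v dot_square_norm power2_eq_square proj_inner v_def)
  also have "\<dots> = proj ip U f \<bullet> T v" using T(1,3)[OF v] by (simp add: proj_inner U)
  also have "\<dots> \<le> norm (proj ip U f) * (C * norm v)"
    by (rule order_trans[OF norm_cauchy_schwarz mult_left_mono[OF T(2)[OF v]]]) simp
  finally show ?thesis using \<open>0 \<le> C\<close>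
    by (cases "v = 0") (auto simp: v_def[symmetric] mult.commute mult.left_commute)
qed

end

section \<open>The pseudo-inverse of an operator with closed range\<close>

definition penrose_inverse ::
    "('k::real_or_complex \<Rightarrow> 'h::real_inner \<Rightarrow> 'h) \<Rightarrow> ('h \<Rightarrow> 'h \<Rightarrow> 'k) \<Rightarrow> ('h \<Rightarrow> 'h) \<Rightarrow> ('h \<Rightarrow> 'h) \<Rightarrow> bool" where
  "penrose_inverse smul ip K X \<longleftrightarrow> bounded_operator smul X \<and>
     K \<circ> X \<circ> K = K \<and> X \<circ> K \<circ> X = X \<and>
     adj ip (K \<circ> X) = K \<circ> X \<and> adj ip (X \<circ> K) = X \<circ> K"

context hilbert_space
begin

lemma closed_subspace_range:
  "bounded_operator smul K \<Longrightarrow> closed (range K) \<Longrightarrow> closed_subspace smul (range K)"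
  by (intro closed_subspace_image closed_subspace_UNIV)

lemma closed_subspace_coercive_image:
  assumes T: "bounded_operator smul T" and M: "closed_subspace smul M" and c: "0 < c"
    and coercive: "\<And>f. f \<in> M \<Longrightarrow> norm f \<le> c * norm (T f)"
  shows "closed_subspace smul (T ` M)"
proof -
  have "complete M"
    using closed_subspace_closed[OF M] complete_closed_subset[of M UNIV] complete_UNIV by auto
  moreover have "\<forall>f\<in>M. norm (T f) \<ge> 1 / c * norm f"
    using coercive c by (simp add: field_simps)
  ultimately have "complete (T ` M)"
    using c closed_subspace_real[OF M] bounded_operator_linear[OF T]
    by (intro complete_isometric_image[of "1 / c"]) auto
  then show ?thesis by (intro closed_subspace_image T M complete_imp_closed)
qed

text \<open>
  The closed range theorem in the form needed here. The vectors \<open>f\<close> of \<open>R(K)\<close> with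
  \<open>\<parallel>K\<^sup>* f\<parallel> \<le> 1\<close> are weakly bounded: \<open>f \<bullet> h = f \<bullet> \<pi> h\<close>, and since \<open>R(K)\<close> is closed,
  \<open>\<pi> h = K x\<close> for some \<open>x\<close>, so that \<open>\<bar>f \<bullet> h\<bar> = \<bar>K\<^sup>* f \<bullet> x\<bar> \<le> \<parallel>x\<parallel>\<close>. Uniform boundedness then
  bounds their norms.
\<close>

lemma adj_coercive_on_range:
  assumes K: "bounded_operator smul K" and closed: "closed (range K)"
  obtains c where "0 < c" "\<And>f. f \<in> range K \<Longrightarrow> norm f \<le> c * norm (adj ip K f)"
proof -
  note R = closed_subspace_range[OF K closed]
  interpret Ka: bounded_linear "adj ip K"
    by (intro bounded_operator_linear bounded_operator_adj K)
  define F where "F = {f \<in> range K. norm (adj ip K f) \<le> 1}"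
  have "\<exists>C. \<forall>f\<in>F. \<bar>f \<bullet> h\<bar> \<le> C" for h
  proof -
    obtain x where x: "proj ip (range K) h = K x" using proj_in[OF R, of h] by auto
    have "\<bar>f \<bullet> h\<bar> \<le> norm x" if f: "f \<in> F" for f
    proof -
      have "f \<bullet> h = x \<bullet> adj ip K f"
        using f proj_inner[OF R, of f h] inner_adj[OF K, of x f]
        by (simp add: F_def x inner_commute)
      also have "\<bar>\<dots>\<bar> \<le> norm x * norm (adj ip K f)" by (rule Cauchy_Schwarz_ineq2)
      also have "\<dots> \<le> norm x * 1" using f by (intro mult_left_mono) (auto simp: F_def)
      finally show ?thesis by simp
    qed
    then show ?thesis by blast
  qed
  then obtain C where C: "\<And>f. f \<in> F \<Longrightarrow> norm f \<le> C"
    using weakly_bounded_imp_bounded[of F] by blast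
  \<comment> \<open>\<open>C\<close> itself need not be positive, for instance when \<open>K = 0\<close>.\<close>
  have "norm f \<le> max C 1 * norm (adj ip K f)" if f: "f \<in> range K" for f
  proof (cases "adj ip K f = 0")
    case True
    from f obtain x where "f = K x" by auto
    then have "f \<bullet> f = 0" using inner_adj[OF K, of x f] True by simp
    then show ?thesis using True by simp
  next
    case False
    have "(1 / norm (adj ip K f)) *\<^sub>R f \<in> F"
      using f False closed_subspace_real[OF R]
      by (auto simp: F_def Ka.scaleR intro: Real_Vector_Spaces.subspace_scale)
    from C[OF this] have "norm f \<le> C * norm (adj ip K f)"
      using False by (simp add: field_simps)
    also have "\<dots> \<le> max C 1 * norm (adj ip K f)" by (intro mult_right_mono) auto
    finally show ?thesis .
  qed
  then show thesis by (intro that[of "max C 1"]) auto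
qed

text \<open>
  The inverse sends \<open>y\<close> to the solution of \<open>K x = \<pi> y\<close> that lies in \<open>V = K\<^sup>*(R(K))\<close>, where \<open>\<pi>\<close>
  projects onto \<open>R(K)\<close>. It exists by solving the normal equation for \<open>p\<close> and taking
  \<open>x = K\<^sup>* p\<close>, and it is unique because \<open>V\<close> is orthogonal to the kernel of \<open>K\<close>. Linearity, the
  norm bound and the Penrose equations all follow from this description: \<open>K \<circ> X\<close> is the
  projection onto \<open>R(K)\<close> and \<open>X \<circ> K\<close> the one onto \<open>V\<close>.
\<close>

lemma penrose_inverse_exists:
  assumes K: "bounded_operator smul K" and closed: "closed (range K)"
  shows "\<exists>X. penrose_inverse smul ip K X"
proof -
  note R = closed_subspace_range[OF K closed]
  note Ka = bounded_operator_adj[OF K]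
  interpret K: bounded_linear K by (rule bounded_operator_linear[OF K])
  obtain c where c: "0 < c" "\<And>f. f \<in> range K \<Longrightarrow> norm f \<le> c * norm (adj ip K f)"
    using adj_coercive_on_range[OF K closed] by blast
  define V where "V = adj ip K ` range K"
  have V: "closed_subspace smul V"
    unfolding V_def by (rule closed_subspace_coercive_image[OF Ka R c])
  note subV = closed_subspace_real[OF V]
  have orth: "v \<bullet> z = 0" if "v \<in> V" "K z = 0" for v z
    using that by (auto simp: V_def adj_inner[OF K])
  have inj: "x = x'" if "x \<in> V" "x' \<in> V" "K x = K x'" for x x'
  proof -
    have "x - x' \<in> V" using that subV by (simp add: Real_Vector_Spaces.subspace_diff)
    from orth[OF this, of "x - x'"] show ?thesis using that by (simp add: K.diff)
  qed
  have "\<exists>x\<in>V. K x = proj ip (range K) y" for y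
  proof -
    obtain p where p: "p \<in> range K" "\<forall>v\<in>range K. adj ip K p \<bullet> adj ip K v = y \<bullet> v"
      using riesz_coercive[OF closed_subspace_real[OF R] closed bounded_operator_linear[OF Ka]
          bounded_linear_inner_right c(2)] by blast
    have "proj ip (range K) y = K (adj ip K p)"
      by (rule proj_eqI[OF R]) (use p in \<open>auto simp: inner_adj[OF K]\<close>)
    then show ?thesis using p(1) by (auto simp: V_def)
  qed
  then obtain X where X: "\<And>y. X y \<in> V" "\<And>y. K (X y) = proj ip (range K) y" by metis
  note P = bounded_operator_proj[OF R]
  interpret P: bounded_linear "proj ip (range K)" by (rule bounded_operator_linear[OF P])
  have bX: "bounded_operator smul X"
  proof (rule bounded_operatorI[where C = c])
    fix x y a
    show "X (x + y) = X x + X y"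
      by (rule inj) (auto simp: X K.add P.add subV Real_Vector_Spaces.subspace_add)
    show "X (smul a x) = smul a (X x)"
      by (rule inj) (auto simp: X V closed_subspace_smul bounded_operator_smul[OF K]
          bounded_operator_smul[OF P])
    obtain f where f: "f \<in> range K" "X x = adj ip K f" using X(1)[of x] by (auto simp: V_def)
    have "norm (X x) * norm (X x) = f \<bullet> proj ip (range K) x"
      using adj_inner[OF K, of f "X x"] by (simp add: X f(2)[symmetric] dot_square_norm power2_eq_square)
    also have "\<dots> \<le> norm f * norm x"
      by (rule order_trans[OF norm_cauchy_schwarz mult_left_mono[OF norm_proj_le[OF R]]]) simp
    also have "\<dots> \<le> c * norm (X x) * norm x"
      using c(2)[OF f(1)] by (intro mult_right_mono) (auto simp: f(2))
    finally show "norm (X x) \<le> c * norm x"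
      using c(1) by (cases "X x = 0") auto
  qed
  have KXK: "K (X (K x)) = K x" for x by (simp add: X proj_ident[OF R])
  have XK: "X (K v) = v" if "v \<in> V" for v
    by (rule inj) (auto simp: X that proj_ident[OF R])
  have XK_inner: "X (K x) \<bullet> z = X (K x) \<bullet> X (K z)" for x z
    using orth[OF X(1), of "z - X (K z)" "K x"] by (simp add: K.diff KXK inner_diff_right)
  have "penrose_inverse smul ip K X"
    unfolding penrose_inverse_def
  proof (intro conjI)
    show "adj ip (K \<circ> X) = K \<circ> X"
      by (rule adj_eqI) (simp_all add: bounded_operator_comp K bX X proj_symmetric[OF R])
    show "adj ip (X \<circ> K) = X \<circ> K"
      by (rule adj_eqI) (simp add: bounded_operator_comp K bX, metis comp_apply XK_inner inner_commute)
  qed (auto simp: bX KXK XK[OF X(1)])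
  then show ?thesis by blast
qed

text \<open>
  Inserting \<open>K = K Y K\<close> and taking adjoints shows that \<open>K X\<close> and \<open>X K\<close> do not depend on the
  choice of \<open>X\<close>; and \<open>X = X K X\<close> is determined by these two products.
\<close>

lemma penrose_inverse_unique:
  assumes K: "bounded_operator smul K"
    and X: "penrose_inverse smul ip K X" and Y: "penrose_inverse smul ip K Y"
  shows "X = Y"
proof -
  have bd: "bounded_operator smul (K \<circ> X)" "bounded_operator smul (K \<circ> Y)"
      "bounded_operator smul (X \<circ> K)" "bounded_operator smul (Y \<circ> K)"
    using X Y K by (auto simp: penrose_inverse_def intro: bounded_operator_comp)
  have eqX: "K \<circ> X \<circ> K = K" "X \<circ> K \<circ> X = X" "adj ip (K \<circ> X) = K \<circ> X" "adj ip (X \<circ> K) = X \<circ> K"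
    and eqY: "K \<circ> Y \<circ> K = K" "Y \<circ> K \<circ> Y = Y" "adj ip (K \<circ> Y) = K \<circ> Y" "adj ip (Y \<circ> K) = Y \<circ> K"
    using X Y by (auto simp: penrose_inverse_def)
  have "K \<circ> X = adj ip ((K \<circ> Y) \<circ> (K \<circ> X))" by (metis comp_assoc eqX(3) eqY(1))
  also have "\<dots> = (K \<circ> X) \<circ> (K \<circ> Y)" using bd by (simp add: adj_comp eqX eqY)
  also have "\<dots> = K \<circ> Y" by (metis comp_assoc eqX(1))
  finally have KX: "K \<circ> X = K \<circ> Y" .
  have "X \<circ> K = adj ip ((X \<circ> K) \<circ> (Y \<circ> K))" by (metis comp_assoc eqX(4) eqY(1))
  also have "\<dots> = (Y \<circ> K) \<circ> (X \<circ> K)" using bd by (simp add: adj_comp eqX eqY)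
  also have "\<dots> = Y \<circ> K" by (metis comp_assoc eqX(1))
  finally have XK: "X \<circ> K = Y \<circ> K" .
  have "X = X \<circ> K \<circ> X" by (simp add: eqX)
  also have "\<dots> = Y \<circ> (K \<circ> X)" by (simp add: XK comp_assoc)
  also have "\<dots> = Y" by (simp add: KX eqY flip: comp_assoc)
  finally show ?thesis .
qed

lemma penrose_inverse_pseudo_inverse:
  assumes K: "bounded_operator smul K" and closed: "closed (range K)"
  shows "penrose_inverse smul ip K (pseudo_inverse smul ip K)"
proof -
  have "\<exists>!X. penrose_inverse smul ip K X"
    using penrose_inverse_exists[OF assms] penrose_inverse_unique[OF K] by blast
  from theI'[OF this] show ?thesis
    unfolding pseudo_inverse_def penrose_inverse_def .
qed

end

section \<open>Transfer of fusion frames\<close>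

lemma fusion_term_nonneg: "0 \<le> fusion_term ip V \<omega> f i"
  by (simp add: fusion_term_def)

lemma fusion_sum_le:
  assumes "\<And>i. i \<in> I \<Longrightarrow> norm (proj ip (V i) g) \<le> C * norm (proj ip (U i) f)"
    and U: "fusion_term ip U \<omega> f summable_on I"
  shows "fusion_term ip V \<omega> g summable_on I"
    and "(\<Sum>\<^sub>\<infinity>i\<in>I. fusion_term ip V \<omega> g i) \<le> C\<^sup>2 * (\<Sum>\<^sub>\<infinity>i\<in>I. fusion_term ip U \<omega> f i)"
proof -
  have le: "fusion_term ip V \<omega> g i \<le> C\<^sup>2 * fusion_term ip U \<omega> f i" if "i \<in> I" for i
    using mult_left_mono[OF power_mono[OF assms(1)[OF that], of 2], of "(\<omega> i)\<^sup>2"]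
    by (simp add: fusion_term_def power_mult_distrib mult_ac)
  have sum: "(\<lambda>i. C\<^sup>2 * fusion_term ip U \<omega> f i) summable_on I"
    by (rule summable_on_cmult_right[OF U])
  show V: "fusion_term ip V \<omega> g summable_on I"
    using sum le by (rule summable_on_comparison_test) (auto simp: fusion_term_nonneg)
  show "(\<Sum>\<^sub>\<infinity>i\<in>I. fusion_term ip V \<omega> g i) \<le> C\<^sup>2 * (\<Sum>\<^sub>\<infinity>i\<in>I. fusion_term ip U \<omega> f i)"
    using infsum_mono[OF V sum le] by (simp add: infsum_cmult_right')
qed

context hilbert_space
begin

text \<open>
  \<open>Q\<close> maps \<open>W i\<close> onto \<open>Q ` W i\<close> and \<open>Q\<^sup>-\<^sup>1\<close> maps it back, so the intertwining estimate, used in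
  both directions, makes \<open>\<parallel>\<pi> f\<parallel>\<close> on \<open>Q ` W i\<close> comparable with \<open>\<parallel>\<pi> (Q\<^sup>* f)\<parallel>\<close> on \<open>W i\<close>. It
  remains to use the frame inequality at \<open>Q\<^sup>* f\<close> and \<open>(Q K)\<^sup>* f = K\<^sup>* (Q\<^sup>* f)\<close>.
\<close>

lemma op_fusion_frame_image:
  assumes frame: "op_fusion_frame smul ip K I W \<omega>" and Q: "invertible_operator smul Q"
  shows "op_fusion_frame smul ip (Q \<circ> K) I (\<lambda>i. Q ` W i) \<omega>"
proof -
  obtain A B where K: "bounded_operator smul K" and W: "weighted_subspaces smul I W \<omega>"
    and AB: "0 < A" "0 < B" and sum: "\<And>f. fusion_term ip W \<omega> f summable_on I"
      "\<And>f. A * (norm (adj ip K f))\<^sup>2 \<le> (\<Sum>\<^sub>\<infinity>i\<in>I. fusion_term ip W \<omega> f i)"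
      "\<And>f. (\<Sum>\<^sub>\<infinity>i\<in>I. fusion_term ip W \<omega> f i) \<le> B * (norm f)\<^sup>2"
    using frame unfolding op_fusion_frame_def op_fusion_frame_bounds_def by blast
  obtain R where bQ: "bounded_operator smul Q" and R: "bounded_operator smul R"
    and inv: "Q \<circ> R = id" "R \<circ> Q = id"
    using Q by (auto simp: invertible_operator_def)
  have QR: "Q (R x) = x" and RQ: "R (Q x) = x" for x
    using fun_cong[OF inv(1)] fun_cong[OF inv(2)] by simp_all
  obtain q where q: "0 < q" "\<And>x. norm (Q x) \<le> q * norm x" using bounded_operator_norm_le[OF bQ] by blast
  obtain r where r: "0 < r" "\<And>x. norm (R x) \<le> r * norm x" using bounded_operator_norm_le[OF R] by blast
  obtain s where s: "0 < s" "\<And>x. norm (adj ip Q x) \<le> s * norm x"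
    using bounded_operator_norm_le[OF bounded_operator_adj[OF bQ]] by blast
  have Wi: "closed_subspace smul (W i)" if "i \<in> I" for i using W that by (simp add: weighted_subspaces_def)
  have image: "Q ` W i = R -` W i" for i
  proof (intro set_eqI iffI)
    fix x assume "x \<in> R -` W i"
    then show "x \<in> Q ` W i" using imageI[of "R x" "W i" Q] by (simp add: QR)
  qed (auto simp: RQ)
  have QWi: "closed_subspace smul (Q ` W i)" if "i \<in> I" for i
    unfolding image by (rule closed_subspace_vimage[OF R Wi[OF that]])
  have upper: "norm (proj ip (Q ` W i) f) \<le> r * norm (proj ip (W i) (adj ip Q f))" if "i \<in> I" for i f
    using r Wi[OF that] QWi[OF that]
    by (intro norm_proj_le_of_intertwining[where T = R]) (auto simp: RQ adj_inner[OF bQ])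
  have lower: "norm (proj ip (W i) (adj ip Q f)) \<le> q * norm (proj ip (Q ` W i) f)" if "i \<in> I" for i f
    using q Wi[OF that] QWi[OF that]
    by (intro norm_proj_le_of_intertwining[where T = Q]) (auto simp: adj_inner[OF bQ])
  have "op_fusion_frame_bounds smul ip (Q \<circ> K) I (\<lambda>i. Q ` W i) \<omega> (A / q\<^sup>2) (r\<^sup>2 * (B * s\<^sup>2))"
    unfolding op_fusion_frame_bounds_def
  proof (intro conjI allI)
    fix f
    show summable: "fusion_term ip (\<lambda>i. Q ` W i) \<omega> f summable_on I"
      by (rule fusion_sum_le(1)[OF upper sum(1)])
    have "A * (norm (adj ip (Q \<circ> K) f))\<^sup>2 \<le> (\<Sum>\<^sub>\<infinity>i\<in>I. fusion_term ip W \<omega> (adj ip Q f) i)"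
      using sum(2) by (simp add: adj_comp bQ K)
    also have "\<dots> \<le> q\<^sup>2 * (\<Sum>\<^sub>\<infinity>i\<in>I. fusion_term ip (\<lambda>i. Q ` W i) \<omega> f i)"
      by (rule fusion_sum_le(2)[OF lower summable])
    finally show "A / q\<^sup>2 * (norm (adj ip (Q \<circ> K) f))\<^sup>2
        \<le> (\<Sum>\<^sub>\<infinity>i\<in>I. fusion_term ip (\<lambda>i. Q ` W i) \<omega> f i)"
      using q(1) by (simp add: field_simps)
    have "(\<Sum>\<^sub>\<infinity>i\<in>I. fusion_term ip (\<lambda>i. Q ` W i) \<omega> f i)
        \<le> r\<^sup>2 * (\<Sum>\<^sub>\<infinity>i\<in>I. fusion_term ip W \<omega> (adj ip Q f) i)"
      by (rule fusion_sum_le(2)[OF upper sum(1)])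
    also have "\<dots> \<le> r\<^sup>2 * (B * (norm (adj ip Q f))\<^sup>2)" by (intro mult_left_mono sum(3)) auto
    also have "\<dots> \<le> r\<^sup>2 * (B * (s * norm f)\<^sup>2)"
      using AB(2) by (intro mult_left_mono power_mono s(2)) auto
    finally show "(\<Sum>\<^sub>\<infinity>i\<in>I. fusion_term ip (\<lambda>i. Q ` W i) \<omega> f i) \<le> r\<^sup>2 * (B * s\<^sup>2) * (norm f)\<^sup>2"
      by (simp add: power_mult_distrib mult_ac)
  next
    show "weighted_subspaces smul I (\<lambda>i. Q ` W i) \<omega>"
      using W QWi by (simp add: weighted_subspaces_def)
  qed (use AB q r s bQ K in \<open>auto intro: bounded_operator_comp\<close>)
  then show ?thesis unfolding op_fusion_frame_def by blast
qed

text \<open>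
  The range inclusion gives the factorisation \<open>Q = K (K\<^sup>\<dagger> Q)\<close>, whence \<open>Q\<^sup>* = (K\<^sup>\<dagger> Q)\<^sup>* K\<^sup>*\<close> and
  \<open>\<parallel>Q\<^sup>* f\<parallel> \<le> c \<parallel>K\<^sup>* f\<parallel>\<close>: the lower bound for \<open>K\<close> implies one for \<open>Q\<close>.
\<close>

lemma op_fusion_frame_range_subset:
  assumes frame: "op_fusion_frame smul ip K I W \<omega>" and closed: "closed (range K)"
    and Q: "bounded_operator smul Q" and range: "range Q \<subseteq> range K"
  shows "op_fusion_frame smul ip Q I W \<omega>"
proof -
  obtain A B where K: "bounded_operator smul K" and W: "weighted_subspaces smul I W \<omega>"
    and AB: "0 < A" "0 < B" and sum: "\<And>f. fusion_term ip W \<omega> f summable_on I"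
      "\<And>f. A * (norm (adj ip K f))\<^sup>2 \<le> (\<Sum>\<^sub>\<infinity>i\<in>I. fusion_term ip W \<omega> f i)"
      "\<And>f. (\<Sum>\<^sub>\<infinity>i\<in>I. fusion_term ip W \<omega> f i) \<le> B * (norm f)\<^sup>2"
    using frame unfolding op_fusion_frame_def op_fusion_frame_bounds_def by blast
  define X where "X = pseudo_inverse smul ip K"
  have X: "bounded_operator smul X" "K \<circ> X \<circ> K = K"
    using penrose_inverse_pseudo_inverse[OF K closed] by (simp_all add: X_def penrose_inverse_def)
  have "Q x = K (X (Q x))" for x
  proof -
    obtain y where "Q x = K y" using range by blast
    then show ?thesis using fun_cong[OF X(2), of y] by simp
  qed
  then have factor: "K \<circ> (X \<circ> Q) = Q" by (simp add: fun_eq_iff)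
  have adjQ: "adj ip Q f = adj ip (X \<circ> Q) (adj ip K f)" for f
    using adj_comp[OF K bounded_operator_comp[OF X(1) Q]] by (simp only: factor comp_apply)
  obtain c where c: "0 < c" "\<And>x. norm (adj ip (X \<circ> Q) x) \<le> c * norm x"
    using bounded_operator_norm_le[OF bounded_operator_adj[OF bounded_operator_comp[OF X(1) Q]]] by blast
  have "A / c\<^sup>2 * (norm (adj ip Q f))\<^sup>2 \<le> (\<Sum>\<^sub>\<infinity>i\<in>I. fusion_term ip W \<omega> f i)" for f
  proof -
    have "A / c\<^sup>2 * (norm (adj ip Q f))\<^sup>2 \<le> A / c\<^sup>2 * (c * norm (adj ip K f))\<^sup>2"
      unfolding adjQ using c AB by (intro mult_left_mono power_mono) auto
    also have "\<dots> = A * (norm (adj ip K f))\<^sup>2" using c by (simp add: power_mult_distrib)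
    also have "\<dots> \<le> (\<Sum>\<^sub>\<infinity>i\<in>I. fusion_term ip W \<omega> f i)" by (rule sum(2))
    finally show ?thesis .
  qed
  then have "op_fusion_frame_bounds smul ip Q I W \<omega> (A / c\<^sup>2) B"
    unfolding op_fusion_frame_bounds_def using Q W AB c sum by auto
  then show ?thesis unfolding op_fusion_frame_def by blast
qed

text \<open>
  The common form of the statements about \<open>K\<^sup>\<dagger>\<close> and \<open>S\<^sub>W\<^sup>-\<^sup>1\<close>. Here \<open>L\<close> and \<open>T\<close> are mutually
  inverse between \<open>M\<close> and \<open>N\<close>, and \<open>T\<close> is extended to the whole space through the projection
  \<open>\<pi>\<^sub>N\<close>. For \<open>f\<close> in \<open>M\<close> two facts give the bounds.

  Lower bound: \<open>T\<close> maps \<open>W i\<close> into \<open>T ` W i\<close>, so the sum for \<open>T ` W i\<close> at \<open>f\<close> dominates the sum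
  for \<open>W i\<close> at \<open>T\<^sup>* f\<close>, which dominates \<open>\<parallel>L\<^sup>* T\<^sup>* f\<parallel>\<^sup>2\<close>; and \<open>f \<bullet> f = f \<bullet> T L f\<close> shows
  \<open>\<parallel>f\<parallel> \<le> \<parallel>L\<^sup>* T\<^sup>* f\<parallel>\<close>.

  Upper bound: \<open>L\<close> maps \<open>T ` W i\<close> into \<open>\<pi>\<^sub>N ` W i\<close>, and \<open>f \<bullet> v = T\<^sup>* f \<bullet> L v\<close> there, so the sum
  at \<open>f\<close> is dominated by the Bessel sum at \<open>T\<^sup>* f\<close>.

  The Bessel hypothesis also makes \<open>T ` W i\<close> closed, as \<open>T ` W i = M \<inter> L -` (\<pi>\<^sub>N ` W i)\<close>.
\<close>

lemma fusion_frame_for_image: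
  assumes frame: "op_fusion_frame smul ip L I W \<omega>"
    and T: "bounded_operator smul T" and M: "closed_subspace smul M" and N: "closed_subspace smul N"
    and TM: "\<And>x. T x \<in> M" and TL: "\<And>x. x \<in> M \<Longrightarrow> T (L x) = x"
    and LT: "\<And>y. L (T y) = proj ip N y"
    and bessel: "bessel_fusion_sequence smul ip I (\<lambda>i. proj ip N ` W i) \<omega>"
  shows "fusion_frame_for smul ip M I (\<lambda>i. T ` W i) \<omega>"
proof -
  obtain A B where L: "bounded_operator smul L" and W: "weighted_subspaces smul I W \<omega>"
    and A: "0 < A" and sum: "\<And>f. fusion_term ip W \<omega> f summable_on I"
      "\<And>f. A * (norm (adj ip L f))\<^sup>2 \<le> (\<Sum>\<^sub>\<infinity>i\<in>I. fusion_term ip W \<omega> f i)"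
    using frame unfolding op_fusion_frame_def op_fusion_frame_bounds_def by blast
  define U where "U i = proj ip N ` W i" for i
  obtain D where U: "weighted_subspaces smul I U \<omega>"
    and sumU: "\<And>f. fusion_term ip U \<omega> f summable_on I"
      "\<And>f. (\<Sum>\<^sub>\<infinity>i\<in>I. fusion_term ip U \<omega> f i) \<le> D * (norm f)\<^sup>2"
    using bessel unfolding bessel_fusion_sequence_def U_def[symmetric] by blast
  define V where "V i = T ` W i" for i
  have Wi: "closed_subspace smul (W i)" and Ui: "closed_subspace smul (U i)" and wi: "0 < \<omega> i"
    if "i \<in> I" for i
    using W U that by (simp_all add: weighted_subspaces_def)
  have V_eq: "V i = M \<inter> L -` U i" for i
  proof (intro set_eqI iffI)
    fix v assume "v \<in> M \<inter> L -` U i"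
    then obtain w where w: "w \<in> W i" "L v = proj ip N w" "v \<in> M" by (auto simp: U_def)
    have "v = T (L (T w))" using TL[OF w(3)] by (simp add: w(2) LT)
    then have "v = T w" by (simp add: TL TM)
    then show "v \<in> V i" using w by (auto simp: V_def)
  qed (auto simp: V_def U_def TM LT)
  have Vi: "closed_subspace smul (V i)" if "i \<in> I" for i
    unfolding V_eq by (intro closed_subspace_Int M closed_subspace_vimage L Ui that)
  obtain t where t: "0 < t" "\<And>x. norm (T x) \<le> t * norm x" using bounded_operator_norm_le[OF T] by blast
  obtain l where l: "0 < l" "\<And>x. norm (L x) \<le> l * norm x" using bounded_operator_norm_le[OF L] by blast
  obtain s where s: "0 < s" "\<And>x. norm (adj ip T x) \<le> s * norm x"
    using bounded_operator_norm_le[OF bounded_operator_adj[OF T]] by blast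
  have lower: "norm (proj ip (W i) (adj ip T f)) \<le> t * norm (proj ip (V i) f)" if "i \<in> I" for i f
    using t Wi[OF that] Vi[OF that]
    by (intro norm_proj_le_of_intertwining[where T = T]) (auto simp: adj_inner[OF T] V_def)
  have upper: "norm (proj ip (V i) f) \<le> l * norm (proj ip (U i) (adj ip T f))" if "i \<in> I" for i f
    using l Ui[OF that] Vi[OF that]
    by (intro norm_proj_le_of_intertwining[where T = L]) (auto simp: adj_inner[OF T] V_eq TL)
  \<comment> \<open>A Bessel bound \<open>D\<close> may be negative on the zero space, and the maximum ensures \<open>A' \<le> B'\<close>.\<close>
  define A' B' where "A' = A / t\<^sup>2" and "B' = max A' (l\<^sup>2 * (\<bar>D\<bar> * s\<^sup>2))"
  have "0 < A' \<and> A' \<le> B' \<and> (\<forall>f\<in>M. fusion_term ip V \<omega> f summable_on I \<and>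
      A' * (norm f)\<^sup>2 \<le> (\<Sum>\<^sub>\<infinity>i\<in>I. fusion_term ip V \<omega> f i) \<and>
      (\<Sum>\<^sub>\<infinity>i\<in>I. fusion_term ip V \<omega> f i) \<le> B' * (norm f)\<^sup>2)"
  proof (intro conjI ballI)
    fix f assume f: "f \<in> M"
    show summable: "fusion_term ip V \<omega> f summable_on I" by (rule fusion_sum_le(1)[OF upper sumU(1)])
    have "norm f * norm f = f \<bullet> T (L f)" by (simp add: TL[OF f] dot_square_norm power2_eq_square)
    also have "\<dots> = adj ip L (adj ip T f) \<bullet> f" by (simp add: adj_inner L T)
    also have "\<dots> \<le> norm (adj ip L (adj ip T f)) * norm f" by (rule norm_cauchy_schwarz)
    finally have "norm f \<le> norm (adj ip L (adj ip T f))" by (cases "f = 0") auto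
    then have "A * (norm f)\<^sup>2 \<le> A * (norm (adj ip L (adj ip T f)))\<^sup>2"
      using A by (intro mult_left_mono power_mono) auto
    also have "\<dots> \<le> (\<Sum>\<^sub>\<infinity>i\<in>I. fusion_term ip W \<omega> (adj ip T f) i)" by (rule sum(2))
    also have "\<dots> \<le> t\<^sup>2 * (\<Sum>\<^sub>\<infinity>i\<in>I. fusion_term ip V \<omega> f i)"
      by (rule fusion_sum_le(2)[OF lower summable])
    finally show "A' * (norm f)\<^sup>2 \<le> (\<Sum>\<^sub>\<infinity>i\<in>I. fusion_term ip V \<omega> f i)"
      using t(1) by (simp add: A'_def field_simps)
    have "(\<Sum>\<^sub>\<infinity>i\<in>I. fusion_term ip V \<omega> f i) \<le> l\<^sup>2 * (\<Sum>\<^sub>\<infinity>i\<in>I. fusion_term ip U \<omega> (adj ip T f) i)"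
      by (rule fusion_sum_le(2)[OF upper sumU(1)])
    also have "\<dots> \<le> l\<^sup>2 * (D * (norm (adj ip T f))\<^sup>2)" by (intro mult_left_mono sumU(2)) auto
    also have "\<dots> \<le> l\<^sup>2 * (\<bar>D\<bar> * (s * norm f)\<^sup>2)"
      by (intro mult_left_mono mult_mono power_mono s(2)) auto
    also have "\<dots> \<le> B' * (norm f)\<^sup>2"
      by (simp add: B'_def power_mult_distrib mult_right_mono flip: mult.assoc)
    finally show "(\<Sum>\<^sub>\<infinity>i\<in>I. fusion_term ip V \<omega> f i) \<le> B' * (norm f)\<^sup>2" .
  qed (use A t in \<open>auto simp: A'_def B'_def\<close>)
  then have bounds: "\<exists>A B. 0 < A \<and> A \<le> B \<and> (\<forall>f\<in>M. fusion_term ip V \<omega> f summable_on I \<and>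
      A * (norm f)\<^sup>2 \<le> (\<Sum>\<^sub>\<infinity>i\<in>I. fusion_term ip V \<omega> f i) \<and>
      (\<Sum>\<^sub>\<infinity>i\<in>I. fusion_term ip V \<omega> f i) \<le> B * (norm f)\<^sup>2)"
    by blast
  have "V i \<subseteq> M" for i by (auto simp: V_eq)
  then have "fusion_frame_for smul ip M I V \<omega>"
    unfolding fusion_frame_for_def weighted_subspaces_def
    by (intro conjI bounds ballI M Vi wi)
  then show ?thesis by (simp only: V_def[abs_def])
qed

end

section \<open>The frame operator\<close>

text \<open>
  A Cauchy criterion for families whose norms need not be summable: the squared norms of the
  partial sums are dominated by those of a summable real family. The constant
  \<open>e\<^sup>2 / (4 * B)\<close> in the proof puts each partial sum within \<open>e / 2\<close> of a fixed one.
\<close>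

lemma summable_if_square_norm_sum_le:
  fixes v :: "'i \<Rightarrow> 'h::{real_inner, complete_space}" and t :: "'i \<Rightarrow> real"
  assumes t: "t summable_on I" "\<And>i. i \<in> I \<Longrightarrow> 0 \<le> t i" and B: "0 < B"
    and le: "\<And>F. finite F \<Longrightarrow> F \<subseteq> I \<Longrightarrow> (norm (sum v F))\<^sup>2 \<le> B * sum t F"
  shows "v summable_on I"
proof -
  let ?G = "filtermap (sum v) (finite_subsets_at_top I)"
  have "cauchy_filter ?G"
    unfolding cauchy_filter_metric_filtermap
  proof (intro allI impI)
    fix e :: real assume e: "0 < e"
    have "((\<lambda>F. sum t F) \<longlongrightarrow> infsum t I) (finite_subsets_at_top I)"
      by (rule infsum_tendsto[OF t(1)])
    moreover have "infsum t I - e\<^sup>2 / (4 * B) < infsum t I" using e B by simp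
    ultimately have "\<forall>\<^sub>F F in finite_subsets_at_top I. infsum t I - e\<^sup>2 / (4 * B) < sum t F"
      by (rule order_tendstoD(1))
    then obtain F0 where F0: "finite F0" "F0 \<subseteq> I" "infsum t I - e\<^sup>2 / (4 * B) < sum t F0"
      unfolding eventually_finite_subsets_at_top by blast
    have close: "norm (sum v F - sum v F0) < e / 2" if F: "finite F" "F0 \<subseteq> F" "F \<subseteq> I" for F
    proof -
      have "(norm (sum v F - sum v F0))\<^sup>2 = (norm (sum v (F - F0)))\<^sup>2"
        using F by (simp add: sum_diff)
      also have "\<dots> \<le> B * sum t (F - F0)" using F by (intro le) auto
      also have "\<dots> = B * (sum t F - sum t F0)" using F by (simp add: sum_diff)
      also have "\<dots> \<le> B * (infsum t I - sum t F0)"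
        using F t B by (intro mult_left_mono diff_right_mono finite_sum_le_infsum) auto
      also have "\<dots> < B * (e\<^sup>2 / (4 * B))" using F0(3) B by (intro mult_strict_left_mono) auto
      also have "\<dots> = (e / 2)\<^sup>2" using B by (simp add: power2_eq_square)
      finally show ?thesis by (rule power_less_imp_less_base) (use e in simp)
    qed
    show "\<exists>P. eventually P (finite_subsets_at_top I) \<and>
        (\<forall>F F'. P F \<and> P F' \<longrightarrow> dist (sum v F) (sum v F') < e)"
    proof (intro exI[of _ "\<lambda>F. finite F \<and> F0 \<subseteq> F \<and> F \<subseteq> I"] conjI allI impI)
      show "\<forall>\<^sub>F F in finite_subsets_at_top I. finite F \<and> F0 \<subseteq> F \<and> F \<subseteq> I"
        unfolding eventually_finite_subsets_at_top using F0(1,2) by (intro exI[of _ F0]) auto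
      fix F F' assume "(finite F \<and> F0 \<subseteq> F \<and> F \<subseteq> I) \<and> finite F' \<and> F0 \<subseteq> F' \<and> F' \<subseteq> I"
      then show "dist (sum v F) (sum v F') < e"
        using close[of F] close[of F'] norm_triangle_ineq4[of "sum v F - sum v F0" "sum v F' - sum v F0"]
        by (simp add: dist_norm)
    qed
  qed
  moreover have "?G \<noteq> bot" by (simp add: filtermap_bot_iff)
  ultimately obtain x where "?G \<le> nhds x"
    using cauchy_filter_complete_converges[of ?G UNIV] complete_UNIV by auto
  then show ?thesis unfolding summable_on_def has_sum_def filterlim_def by blast
qed

context hilbert_space
begin

lemma bounded_linear_smul: "bounded_linear (smul c)"
proof (rule bounded_linear_intro[where K = "norm c"])
  show "smul c (r *\<^sub>R x) = r *\<^sub>R smul c x" for r x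
    by (simp add: mult.commute flip: scale_of_real)
qed (simp_all add: scale_right_distrib norm_smul mult.commute)

context
  fixes I :: "'i set" and W :: "'i \<Rightarrow> 'h set" and \<omega> :: "'i \<Rightarrow> real" and B :: real
  assumes W: "weighted_subspaces smul I W \<omega>" and B: "0 < B"
    and summable: "\<And>f. fusion_term ip W \<omega> f summable_on I"
    and bessel: "\<And>f. (\<Sum>\<^sub>\<infinity>i\<in>I. fusion_term ip W \<omega> f i) \<le> B * (norm f)\<^sup>2"
begin

lemma W_closed_subspace: "i \<in> I \<Longrightarrow> closed_subspace smul (W i)"
  using W by (simp add: weighted_subspaces_def)

text \<open>
  For \<open>s\<close> the partial sum, \<open>s \<bullet> s\<close> is a sum of the products \<open>\<omega>\<^sup>2 \<pi> f \<bullet> \<pi> s\<close>; the Cauchy--Schwarz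
  inequality for sums and the Bessel bound at \<open>s\<close> give
  \<open>\<parallel>s\<parallel>\<^sup>4 \<le> (\<Sum>i\<in>F. fusion_term ip W \<omega> f i) * B * \<parallel>s\<parallel>\<^sup>2\<close>.
\<close>

lemma norm_partial_frame_operator_le:
  assumes F: "finite F" "F \<subseteq> I"
  shows "(norm (\<Sum>i\<in>F. (\<omega> i)\<^sup>2 *\<^sub>R proj ip (W i) f))\<^sup>2 \<le> B * (\<Sum>i\<in>F. fusion_term ip W \<omega> f i)"
proof -
  define s where "s = (\<Sum>i\<in>F. (\<omega> i)\<^sup>2 *\<^sub>R proj ip (W i) f)"
  define n where "n i g = \<omega> i * norm (proj ip (W i) g)" for i g
  have term_eq: "fusion_term ip W \<omega> g i = (n i g)\<^sup>2" for g i
    by (simp add: fusion_term_def n_def power_mult_distrib)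
  have "s \<bullet> s = (\<Sum>i\<in>F. (\<omega> i)\<^sup>2 * (proj ip (W i) f \<bullet> s))"
    by (subst (1) s_def) (simp add: inner_sum_left)
  also have "\<dots> \<le> (\<Sum>i\<in>F. n i f * n i s)"
  proof (rule sum_mono)
    fix i assume "i \<in> F"
    then have Wi: "closed_subspace smul (W i)" using F W_closed_subspace by auto
    have "proj ip (W i) f \<bullet> s = proj ip (W i) f \<bullet> proj ip (W i) s"
      by (metis Wi inner_commute proj_in proj_inner)
    also have "\<dots> \<le> norm (proj ip (W i) f) * norm (proj ip (W i) s)" by (rule norm_cauchy_schwarz)
    finally have "(\<omega> i)\<^sup>2 * (proj ip (W i) f \<bullet> s)
        \<le> (\<omega> i)\<^sup>2 * (norm (proj ip (W i) f) * norm (proj ip (W i) s))"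
      by (intro mult_left_mono) auto
    then show "(\<omega> i)\<^sup>2 * (proj ip (W i) f \<bullet> s) \<le> n i f * n i s"
      by (simp add: n_def power2_eq_square mult_ac)
  qed
  finally have "(norm s)\<^sup>2 \<le> (\<Sum>i\<in>F. n i f * n i s)" by (simp add: power2_norm_eq_inner)
  then have "((norm s)\<^sup>2)\<^sup>2 \<le> (\<Sum>i\<in>F. n i f * n i s)\<^sup>2" by (intro power_mono) auto
  also have "\<dots> \<le> (\<Sum>i\<in>F. (n i f)\<^sup>2) * (\<Sum>i\<in>F. (n i s)\<^sup>2)" by (rule Cauchy_Schwarz_ineq_sum)
  also have "\<dots> \<le> (\<Sum>i\<in>F. (n i f)\<^sup>2) * (B * (norm s)\<^sup>2)"
  proof (intro mult_left_mono sum_nonneg)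
    have "(\<Sum>i\<in>F. (n i s)\<^sup>2) \<le> (\<Sum>\<^sub>\<infinity>i\<in>I. fusion_term ip W \<omega> s i)"
      unfolding term_eq[symmetric]
      by (rule finite_sum_le_infsum[OF summable F]) (simp add: fusion_term_nonneg)
    then show "(\<Sum>i\<in>F. (n i s)\<^sup>2) \<le> B * (norm s)\<^sup>2" using bessel[of s] by simp
  qed simp
  finally have "(norm s)\<^sup>2 * (norm s)\<^sup>2 \<le> B * (\<Sum>i\<in>F. (n i f)\<^sup>2) * (norm s)\<^sup>2"
    by (simp only: power2_eq_square mult_ac)
  then have "(norm s)\<^sup>2 \<le> B * (\<Sum>i\<in>F. (n i f)\<^sup>2)"
  proof (cases "s = 0")
    case False
    with mult_right_le_imp_le[OF \<open>(norm s)\<^sup>2 * (norm s)\<^sup>2 \<le> _\<close>] show ?thesis by simp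
  qed (use B in \<open>simp add: sum_nonneg\<close>)
  then show ?thesis by (simp add: s_def term_eq)
qed

lemma frame_operator_has_sum:
  "((\<lambda>i. (\<omega> i)\<^sup>2 *\<^sub>R proj ip (W i) f) has_sum frame_operator ip I W \<omega> f) I"
  unfolding frame_operator_def
  by (rule has_sum_infsum)
    (rule summable_if_square_norm_sum_le[OF summable[of f] fusion_term_nonneg B norm_partial_frame_operator_le])

lemma norm_frame_operator_le:
  "(norm (frame_operator ip I W \<omega> f))\<^sup>2 \<le> B * (\<Sum>\<^sub>\<infinity>i\<in>I. fusion_term ip W \<omega> f i)"
proof (rule tendsto_upperbound)
  show "((\<lambda>F. (norm (\<Sum>i\<in>F. (\<omega> i)\<^sup>2 *\<^sub>R proj ip (W i) f))\<^sup>2) \<longlongrightarrow>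
      (norm (frame_operator ip I W \<omega> f))\<^sup>2) (finite_subsets_at_top I)"
    using frame_operator_has_sum[of f] unfolding has_sum_def by (intro tendsto_intros)
  have "(norm (\<Sum>i\<in>F. (\<omega> i)\<^sup>2 *\<^sub>R proj ip (W i) f))\<^sup>2 \<le> B * (\<Sum>\<^sub>\<infinity>i\<in>I. fusion_term ip W \<omega> f i)"
    if "finite F" "F \<subseteq> I" for F
    using B by (intro order_trans[OF norm_partial_frame_operator_le[OF that]] mult_left_mono
        finite_sum_le_infsum summable that fusion_term_nonneg) auto
  then show "\<forall>\<^sub>F F in finite_subsets_at_top I. (norm (\<Sum>i\<in>F. (\<omega> i)\<^sup>2 *\<^sub>R proj ip (W i) f))\<^sup>2
      \<le> B * (\<Sum>\<^sub>\<infinity>i\<in>I. fusion_term ip W \<omega> f i)"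
    by (auto simp: eventually_finite_subsets_at_top)
qed simp

lemma bounded_operator_frame_operator: "bounded_operator smul (frame_operator ip I W \<omega>)"
proof (rule bounded_operatorI[where C = B])
  let ?S = "frame_operator ip I W \<omega>"
  note P = bounded_operator_proj[OF W_closed_subspace]
  fix f g c
  have "((\<lambda>i. (\<omega> i)\<^sup>2 *\<^sub>R proj ip (W i) (f + g)) has_sum (?S f + ?S g)) I"
    using has_sum_add[OF frame_operator_has_sum[of f] frame_operator_has_sum[of g]]
    by (rule has_sum_cong[THEN iffD1, rotated])
      (simp add: linear_add[OF bounded_linear.linear[OF bounded_operator_linear[OF P]]] scaleR_add_right)
  then show "?S (f + g) = ?S f + ?S g" by (rule has_sum_unique[OF frame_operator_has_sum])
  have "((\<lambda>i. (\<omega> i)\<^sup>2 *\<^sub>R proj ip (W i) (smul c f)) has_sum smul c (?S f)) I"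
    using has_sum_bounded_linear[OF bounded_linear_smul frame_operator_has_sum[of f], of c]
    by (rule has_sum_cong[THEN iffD1, rotated])
      (simp add: bounded_operator_smul[OF P] mult.commute flip: scale_of_real)
  then show "?S (smul c f) = smul c (?S f)" by (rule has_sum_unique[OF frame_operator_has_sum])
  have "(norm (?S f))\<^sup>2 \<le> B * (B * (norm f)\<^sup>2)"
    using order_trans[OF norm_frame_operator_le mult_left_mono[OF bessel]] B by auto
  then have "(norm (?S f))\<^sup>2 \<le> (B * norm f)\<^sup>2" by (simp add: power2_eq_square mult_ac)
  then show "norm (?S f) \<le> B * norm f" using B by (auto intro: power2_le_imp_le)
qed

lemma frame_operator_inner:
  "((\<lambda>i. (\<omega> i)\<^sup>2 * (proj ip (W i) f \<bullet> g)) has_sum (frame_operator ip I W \<omega> f \<bullet> g)) I"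
  using has_sum_bounded_linear[OF bounded_linear_inner_left frame_operator_has_sum] by simp

lemma frame_operator_inner_self:
  "frame_operator ip I W \<omega> f \<bullet> f = (\<Sum>\<^sub>\<infinity>i\<in>I. fusion_term ip W \<omega> f i)"
proof -
  have "((\<lambda>i. fusion_term ip W \<omega> f i) has_sum (frame_operator ip I W \<omega> f \<bullet> f)) I"
    using frame_operator_inner[of f f]
    by (rule has_sum_cong[THEN iffD1, rotated])
      (metis (no_types) W_closed_subspace fusion_term_def inner_commute power2_norm_eq_inner proj_in proj_inner)
  then show ?thesis by (simp add: infsumI)
qed

lemma adj_frame_operator: "adj ip (frame_operator ip I W \<omega>) = frame_operator ip I W \<omega>"
proof (rule adj_eqI[OF bounded_operator_frame_operator])
  fix f g
  have "((\<lambda>i. (\<omega> i)\<^sup>2 * (proj ip (W i) f \<bullet> g)) has_sum (frame_operator ip I W \<omega> g \<bullet> f)) I"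
    using frame_operator_inner[of g f]
    by (rule has_sum_cong[THEN iffD1, rotated])
      (subst proj_symmetric[OF W_closed_subspace], simp_all add: inner_commute)
  from has_sum_unique[OF frame_operator_inner this]
  show "frame_operator ip I W \<omega> f \<bullet> g = f \<bullet> frame_operator ip I W \<omega> g"
    by (simp add: inner_commute)
qed

text \<open>
  A Bessel fusion sequence is a fusion frame relative to its own frame operator: since \<open>S\<^sub>W\<close> is
  self-adjoint, the lower bound is \<open>\<parallel>S\<^sub>W f\<parallel>\<^sup>2 \<le> B S\<^sub>W f \<bullet> f\<close>. This is what allows \<open>L = S\<^sub>W\<close> in the
  transfer lemma.
\<close>

lemma op_fusion_frame_frame_operator: "op_fusion_frame smul ip (frame_operator ip I W \<omega>) I W \<omega>"
proof -
  have "op_fusion_frame_bounds smul ip (frame_operator ip I W \<omega>) I W \<omega> (1 / B) B"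
    unfolding op_fusion_frame_bounds_def adj_frame_operator
    using W B summable bessel norm_frame_operator_le bounded_operator_frame_operator
    by (simp add: field_simps)
  then show ?thesis unfolding op_fusion_frame_def by blast
qed

end

text \<open>
  The transfer lemma with \<open>L = K\<close>, \<open>T = K\<^sup>\<dagger>\<close>, \<open>M = R(K\<^sup>*)\<close> and \<open>N = R(K)\<close>. Its hypotheses come
  from the Penrose equations: \<open>K\<^sup>\<dagger> K\<close> is self-adjoint, hence equals \<open>K\<^sup>* (K\<^sup>\<dagger>)\<^sup>*\<close> and has
  \<open>R(K\<^sup>*)\<close> as its set of fixed points.
\<close>

lemma fusion_frame_pseudo_inverse_image:
  assumes frame: "op_fusion_frame smul ip K I W \<omega>"
    and K: "bounded_operator smul K" and closed: "closed (range K)"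
    and bessel: "bessel_fusion_sequence smul ip I (\<lambda>i. proj ip (range K) ` W i) \<omega>"
  shows "fusion_frame_for smul ip (range (adj ip K)) I (\<lambda>i. pseudo_inverse smul ip K ` W i) \<omega>"
proof -
  define X where "X = pseudo_inverse smul ip K"
  note R = closed_subspace_range[OF K closed]
  have X: "bounded_operator smul X" "K \<circ> X \<circ> K = K" "X \<circ> K \<circ> X = X"
      "adj ip (K \<circ> X) = K \<circ> X" "adj ip (X \<circ> K) = X \<circ> K"
    using penrose_inverse_pseudo_inverse[OF K closed] by (simp_all add: X_def penrose_inverse_def)
  have KXK: "K (X (K x)) = K x" and XKX: "X (K (X x)) = X x" for x
    using fun_cong[OF X(2), of x] fun_cong[OF X(3), of x] by simp_all
  have KX_inner: "K (X f) \<bullet> g = f \<bullet> K (X g)" for f g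
    using inner_adj[OF bounded_operator_comp[OF K X(1)], of f g] by (simp add: X(4))
  have XK: "X (K x) = adj ip K (adj ip X x)" for x
    using fun_cong[OF X(5), of x] by (simp add: adj_comp X(1) K)
  have range: "range (adj ip K) = {f. X (K f) = f}"
  proof (intro set_eqI iffI)
    fix f assume "f \<in> range (adj ip K)"
    then obtain g where g: "f = adj ip K g" by blast
    have "X (K f) = adj ip (K \<circ> X \<circ> K) g"
      unfolding g XK by (simp add: adj_comp bounded_operator_comp K X(1))
    then show "f \<in> {f. X (K f) = f}" by (simp add: X(2) g)
  next
    fix f assume "f \<in> {f. X (K f) = f}"
    then have "f = adj ip K (adj ip X f)" by (simp flip: XK)
    then show "f \<in> range (adj ip K)" by (rule range_eqI)
  qed
  have "closed (range (adj ip K))"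
    unfolding range using bounded_operator_linear[OF X(1)] bounded_operator_linear[OF K]
    by (intro closed_Collect_eq continuous_on_id linear_continuous_on bounded_linear_compose[of X K])
  then have M: "closed_subspace smul (range (adj ip K))"
    by (intro closed_subspace_range bounded_operator_adj K)
  have KX: "K (X y) = proj ip (range K) y" for y
  proof (rule proj_eqI[OF R, symmetric])
    fix v assume "v \<in> range K"
    then obtain x where "v = K x" by blast
    then show "K (X y) \<bullet> v = y \<bullet> v" by (simp add: KX_inner KXK)
  qed simp
  show ?thesis
    unfolding X_def[symmetric]
  proof (rule fusion_frame_for_image[OF frame X(1) M R _ _ KX bessel])
    show "X y \<in> range (adj ip K)" for y unfolding range by (simp add: XKX)
    show "X (K x) = x" if "x \<in> range (adj ip K)" for x using that unfolding range by simp
  qed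
qed

text \<open>
  The transfer lemma with \<open>L = S\<close>, \<open>T = S\<^sup>-\<^sup>1 \<pi>\<^sub>N\<close>, \<open>M = R(K)\<close> and \<open>N = S(R(K))\<close>. As the range of
  \<open>\<pi>\<^sub>M\<close> is \<open>R(K)\<close>, the family is also a \<open>\<pi>\<^sub>M\<close>-fusion frame, so \<open>A \<parallel>f\<parallel>\<^sup>2 \<le> S f \<bullet> f\<close> on \<open>M\<close>. Hence
  \<open>S\<close> is bounded below on \<open>M\<close>, which makes it injective there, its image \<open>N\<close> closed and \<open>T\<close>
  bounded.
\<close>

lemma fusion_frame_inverse_frame_operator_image:
  assumes frame: "op_fusion_frame smul ip K I W \<omega>"
    and K: "bounded_operator smul K" and closed: "closed (range K)"
  defines "S \<equiv> frame_operator ip I W \<omega>"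
  assumes bessel: "bessel_fusion_sequence smul ip I (\<lambda>i. proj ip (S ` range K) ` W i) \<omega>"
  shows "fusion_frame_for smul ip (range K) I
    (\<lambda>i. inv_into (range K) S ` proj ip (S ` range K) ` W i) \<omega>"
proof -
  define M where "M = range K"
  have M: "closed_subspace smul M" unfolding M_def by (rule closed_subspace_range[OF K closed])
  note P = bounded_operator_proj[OF M]
  have "adj ip (proj ip M) = proj ip M" by (rule adj_eqI[OF P proj_symmetric[OF M]])
  moreover have "op_fusion_frame smul ip (proj ip M) I W \<omega>"
    using proj_in[OF M] by (intro op_fusion_frame_range_subset[OF frame closed P]) (auto simp: M_def)
  ultimately obtain A B where W: "weighted_subspaces smul I W \<omega>" and A: "0 < A" and B: "0 < B"
    and sum: "\<And>f. fusion_term ip W \<omega> f summable_on I"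
      "\<And>f. A * (norm (proj ip M f))\<^sup>2 \<le> (\<Sum>\<^sub>\<infinity>i\<in>I. fusion_term ip W \<omega> f i)"
      "\<And>f. (\<Sum>\<^sub>\<infinity>i\<in>I. fusion_term ip W \<omega> f i) \<le> B * (norm f)\<^sup>2"
    unfolding op_fusion_frame_def op_fusion_frame_bounds_def by metis
  note ctx = W B sum(1) sum(3)
  have S: "bounded_operator smul S"
    unfolding S_def by (rule bounded_operator_frame_operator[OF ctx])
  interpret S: bounded_linear S by (rule bounded_operator_linear[OF S])
  have coercive: "norm f \<le> 1 / A * norm (S f)" if f: "f \<in> M" for f
  proof -
    have "A * norm f * norm f \<le> S f \<bullet> f"
      using sum(2)[of f] frame_operator_inner_self[OF ctx, of f] proj_ident[OF M f]
      by (simp add: S_def power2_eq_square mult.assoc)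
    also have "\<dots> \<le> norm (S f) * norm f" by (rule norm_cauchy_schwarz)
    finally show ?thesis using A by (cases "f = 0") (auto simp: field_simps)
  qed
  have inj: "inj_on S M"
  proof (rule inj_onI)
    fix x y assume xy: "x \<in> M" "y \<in> M" "S x = S y"
    then have "x - y \<in> M" using closed_subspace_real[OF M] by (simp add: Real_Vector_Spaces.subspace_diff)
    from coercive[OF this] show "x = y" using xy by (simp add: S.diff)
  qed
  define N where "N = S ` M"
  have N: "closed_subspace smul N"
    unfolding N_def using closed_subspace_coercive_image[OF S M _ coercive] A by simp
  note PN = bounded_operator_proj[OF N]
  interpret PN: bounded_linear "proj ip N" by (rule bounded_operator_linear[OF PN])
  define T where "T = (\<lambda>y. inv_into M S (proj ip N y))"
  have TM: "T y \<in> M" and ST: "S (T y) = proj ip N y" for y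
    using proj_in[OF N, of y] by (auto simp: T_def N_def inv_into_into f_inv_into_f)
  have T_eqI: "T y = x" if "x \<in> M" "S x = proj ip N y" for x y
    using inj_onD[OF inj _ TM that(1)] ST that(2) by metis
  have TS: "T (S x) = x" if "x \<in> M" for x
    using that proj_ident[OF N, of "S x"] by (intro T_eqI) (auto simp: N_def)
  have T: "bounded_operator smul T"
  proof (rule bounded_operatorI[where C = "1 / A"])
    fix x y c
    show "T (x + y) = T x + T y"
      by (rule T_eqI) (auto simp: TM ST S.add PN.add closed_subspace_real[OF M] Real_Vector_Spaces.subspace_add)
    show "T (smul c x) = smul c (T x)"
      by (rule T_eqI) (auto simp: TM ST M closed_subspace_smul bounded_operator_smul[OF S] bounded_operator_smul[OF PN])
    have "norm (T x) \<le> 1 / A * norm (proj ip N x)" using coercive[OF TM[of x]] by (simp add: ST)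
    also have "\<dots> \<le> 1 / A * norm x" using A by (intro mult_left_mono norm_proj_le N) auto
    finally show "norm (T x) \<le> 1 / A * norm x" .
  qed
  have "fusion_frame_for smul ip M I (\<lambda>i. T ` W i) \<omega>"
  proof (rule fusion_frame_for_image[OF _ T M N TM TS ST])
    show "op_fusion_frame smul ip S I W \<omega>"
      unfolding S_def by (rule op_fusion_frame_frame_operator[OF ctx])
    show "bessel_fusion_sequence smul ip I (\<lambda>i. proj ip N ` W i) \<omega>"
      using bessel by (simp add: N_def M_def)
  qed
  then show ?thesis by (simp add: T_def image_image N_def M_def)
qed

end

section \<open>Operators acting on a fusion frame\<close>

theorem theorem2p5:
  fixes smul :: "'k::real_or_complex \<Rightarrow> 'h::{real_inner, complete_space} \<Rightarrow> 'h"
    and ip :: "'h \<Rightarrow> 'h \<Rightarrow> 'k"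
    and K :: "'h \<Rightarrow> 'h"
    and I :: "'i set"
    and W :: "'i \<Rightarrow> 'h set"
    and \<omega> :: "'i \<Rightarrow> real"
    and A B :: real
  assumes hilbert: "hilbert_space smul ip"
    and separable: "\<exists>D :: 'h set. countable D \<and> closure D = UNIV"
    and index: "countable I"
    and K: "bounded_operator smul K"
    and closed_range: "closed (range K)"
    and frame: "op_fusion_frame_bounds smul ip K I W \<omega> A B"
  shows
    "(bessel_fusion_sequence smul ip I (\<lambda>i. proj ip (range K) ` W i) \<omega> \<longrightarrow>
        fusion_frame_for smul ip (range (adj ip K)) I (\<lambda>i. pseudo_inverse smul ip K ` W i) \<omega>)
   \<and> (let S = frame_operator ip I W \<omega> in
        bessel_fusion_sequence smul ip I (\<lambda>i. proj ip (S ` range K) ` W i) \<omega> \<longrightarrow>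
        fusion_frame_for smul ip (range K) I
          (\<lambda>i. inv_into (range K) S ` proj ip (S ` range K) ` W i) \<omega>)
   \<and> (\<forall>Q. invertible_operator smul Q \<longrightarrow>
        op_fusion_frame smul ip (Q \<circ> K) I (\<lambda>i. Q ` W i) \<omega>)
   \<and> (\<forall>Q. invertible_operator smul Q \<and> K \<circ> Q = Q \<circ> K \<longrightarrow>
        op_fusion_frame smul ip K I (\<lambda>i. Q ` W i) \<omega>)
   \<and> (\<forall>Q. bounded_operator smul Q \<and> range Q \<subseteq> range K \<longrightarrow>
        op_fusion_frame smul ip Q I W \<omega>)"
proof -
  interpret hilbert_space smul ip by (rule hilbert)
  have fr: "op_fusion_frame smul ip K I W \<omega>" using frame unfolding op_fusion_frame_def by blast
  have commuting: "op_fusion_frame smul ip K I (\<lambda>i. Q ` W i) \<omega>"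
    if Q: "invertible_operator smul Q" and comm: "K \<circ> Q = Q \<circ> K" for Q
  proof -
    obtain R where "Q \<circ> R = id" using Q by (auto simp: invertible_operator_def)
    then have "surj Q" by (intro surjI[of Q R]) (simp add: fun_eq_iff)
    have "range (Q \<circ> K) = K ` range Q" by (simp only: image_comp flip: comm)
    also have "\<dots> = range K" by (simp only: \<open>surj Q\<close>)
    finally have "range (Q \<circ> K) = range K" .
    with op_fusion_frame_range_subset[OF op_fusion_frame_image[OF fr Q] _ K] closed_range
    show ?thesis by simp
  qed
  show ?thesis
    unfolding Let_def
  proof (intro conjI allI impI)
    fix Q
    assume "invertible_operator smul Q \<and> K \<circ> Q = Q \<circ> K"
    then show "op_fusion_frame smul ip K I (\<lambda>i. Q ` W i) \<omega>" by (elim conjE) (rule commuting)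
  next
    fix Q
    assume "bounded_operator smul Q \<and> range Q \<subseteq> range K"
    then show "op_fusion_frame smul ip Q I W \<omega>"
      by (elim conjE) (rule op_fusion_frame_range_subset[OF fr closed_range])
  qed (rule fusion_frame_pseudo_inverse_image[OF fr K closed_range]
      fusion_frame_inverse_frame_operator_image[OF fr K closed_range]
      op_fusion_frame_image[OF fr]; assumption)+
qed

end
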